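(* Let $n\ge1$, let $V$ be a complex vector space with $\dim V=2n$, and let $\rho$ be the representation of $\mathfrak{sl}(2n)=\mathfrak{sl}(V)$ on the space of skew-symmetric forms $\Lambda^2(V)$ corresponding to the congruence action. Then the Jordan--Kronecker invariants of $\rho$ are: - $n(2n+1)$ horizontal indices: $1$ taken $3n$ times and $2$ taken $2n(n-1)$ times; - one vertical index $\mathrm{v}_1=n$ (and there are no other blocks).
   Context: Everything is over $\mathbb{C}$ and finite-dimensional. Pencils. For linear maps $A,B:U\to V$ there are bases of $U$ and $V$ (Kronecker's theorem) in which all matrices $A+\lambda B$ are simultaneously block-diagonal, each pair of diagonal blocks $(A_i,B_i)$ being one of: (i) a $k\times k$ Jordan block with eigenvalue $\lambda_0\in\mathbb{C}$: $A_i=J_k(\lambda_0)$ (the upper triangular Jordan block), $B_i=I_k$; (ii) a $k\times k$ Jordan block with eigenvalue $\infty$: $A_i=I_k$, $B_i=J_k(0)$; (iii) a horizontal Kronecker block of size $(h-1)\times h$, $h\ge 1$: $A_i=(0\,|\,I_{h-1})$, $B_i=(I_{h-1}\,|\,0)$; (iv) a vertical Kronecker block of size $v\times(v-1)$, $v\ge1$: the transposes of the matrices in (iii) with $h=v$. A $0\times 1$ horizontal block ($h=1$) is a zero column and a $1\times 0$ vertical block ($v=1$) is a zero row. The blocks are unique up to permutation. The numbers $h$ (widths of horizontal blocks) are the horizontal indices, the numbers $v$ (heights of vertical blocks) are the vertical indices. Representations. For a representation $\rho:\mathfrak{g}\to\mathfrak{gl}(W)$ and $x\in W$ put $R_x:\mathfrak{g}\to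 W$, $R_x(\xi)=\rho(\xi)x$. The algebraic type of the pencil $R_a+\lambda R_b=R_{a+\lambda b}$ is the collection: number of distinct eigenvalues of Jordan blocks, number and sizes of the Jordan blocks for each eigenvalue, horizontal and vertical indices (with multiplicity). The Jordan--Kronecker (JK) invariants of $\rho$ are the algebraic type of $R_{a+\lambda b}$ for a generic pair $(a,b)\in W\times W$ (i.e. for all pairs in some non-empty Zariski open subset). Congruence action. In a fixed basis of $V$, the group $\mathrm{GL}(V)$ acts on bilinear forms (square matrices $Q$) by $(P,Q)\mapsto PQP^T$; the corresponding Lie algebra representation is $\rho(X)Q=XQ+QX^T$. Here it is restricted to traceless $X\in\mathfrak{sl}(V)$ and skew-symmetric matrices $Q\in\Lambda^2(V)$. *)

theory Defs
  imports
    "HOL-Analysis.Analysis"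
    "HOL-Library.Multiset"
    "Jordan_Normal_Form.Jordan_Normal_Form"
begin

section \<open>Kronecker blocks\<close>

datatype pencil_eigenvalue = Finite complex | Infinity

text \<open>\<open>Horizontal h\<close> is the block of size \<open>(h - 1) \<times> h\<close>, \<open>Vertical v\<close> the block of
  size \<open>v \<times> (v - 1)\<close>; blocks with one dimension equal to 0 are legitimate zero columns or rows
  (\<^const>\<open>diag_block_mat\<close> handles them correctly).\<close>

datatype block = Jordan pencil_eigenvalue nat | Horizontal nat | Vertical nat

fun proper_block :: "block \<Rightarrow> bool" where
  "proper_block (Jordan e k) \<longleftrightarrow> k \<ge> 1"
| "proper_block (Horizontal h) \<longleftrightarrow> h \<ge> 1"
| "proper_block (Vertical v) \<longleftrightarrow> v \<ge> 1"

definition shift_right :: "nat \<Rightarrow> complex Matrix.mat" where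
  "shift_right h = Matrix.mat (h - 1) h (\<lambda>(i, j). if j = i + 1 then 1 else 0)"

definition shift_left :: "nat \<Rightarrow> complex Matrix.mat" where
  "shift_left h = Matrix.mat (h - 1) h (\<lambda>(i, j). if j = i then 1 else 0)"

text \<open>\<open>shift_right h\<close> is \<open>(0 | I)\<close> and \<open>shift_left h\<close> is \<open>(I | 0)\<close>. A block stands for the pencil
  \<open>block_A + \<lambda> block_B\<close>.\<close>

fun block_A :: "block \<Rightarrow> complex Matrix.mat" where
  "block_A (Jordan (Finite e) k) = jordan_block k e"
| "block_A (Jordan Infinity k) = 1\<^sub>m k"
| "block_A (Horizontal h) = shift_right h"
| "block_A (Vertical v) = transpose_mat (shift_right v)"

fun block_B :: "block \<Rightarrow> complex Matrix.mat" where
  "block_B (Jordan (Finite e) k) = 1\<^sub>m k"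
| "block_B (Jordan Infinity k) = jordan_block k 0"
| "block_B (Horizontal h) = shift_left h"
| "block_B (Vertical v) = transpose_mat (shift_left v)"


section \<open>Kronecker form of a pencil of linear maps\<close>

text \<open>Vector spaces are subspaces of an ambient type whose scalar multiplication is passed
  explicitly.\<close>

definition ordered_basis :: "(complex \<Rightarrow> 'u::ab_group_add \<Rightarrow> 'u) \<Rightarrow> 'u set \<Rightarrow> 'u list \<Rightarrow> bool" where
  "ordered_basis s U us \<longleftrightarrow>
     distinct us \<and> module.independent s (set us) \<and> module.span s (set us) = U"

definition matrix_represents ::
  "(complex \<Rightarrow> 'v::ab_group_add \<Rightarrow> 'v) \<Rightarrow> 'u list \<Rightarrow> 'v list \<Rightarrow> complex Matrix.mat \<Rightarrow> ('u \<Rightarrow> 'v) \<Rightarrow> bool" where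
  "matrix_represents s us vs M f \<longleftrightarrow>
     M \<in> carrier_mat (length vs) (length us) \<and>
     (\<forall>j < length us. f (us ! j) = (\<Sum>i < length vs. s (M $$ (i, j)) (vs ! i)))"

definition has_Kronecker_form ::
  "(complex \<Rightarrow> 'u::ab_group_add \<Rightarrow> 'u) \<Rightarrow> (complex \<Rightarrow> 'v::ab_group_add \<Rightarrow> 'v) \<Rightarrow>
   'u set \<Rightarrow> 'v set \<Rightarrow> ('u \<Rightarrow> 'v) \<Rightarrow> ('u \<Rightarrow> 'v) \<Rightarrow> block list \<Rightarrow> bool" where
  "has_Kronecker_form sU sV U V A B bs \<longleftrightarrow>
     (\<forall>b \<in> set bs. proper_block b) \<and>
     (\<exists>us vs. ordered_basis sU U us \<and> ordered_basis sV V vs \<and>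
        matrix_represents sV us vs (diag_block_mat (map block_A bs)) A \<and>
        matrix_represents sV us vs (diag_block_mat (map block_B bs)) B)"


section \<open>Algebraic type\<close>

text \<open>The field \<open>jordan_sizes\<close> contains, for each distinct eigenvalue, the multiset of sizes of its
  Jordan blocks; the eigenvalues themselves are forgotten.\<close>

record algebraic_type =
  jordan_sizes :: "nat multiset multiset"
  horizontal_indices :: "nat multiset"
  vertical_indices :: "nat multiset"

definition block_eigenvalues :: "block list \<Rightarrow> pencil_eigenvalue set" where
  "block_eigenvalues bs = {e. \<exists>k. Jordan e k \<in> set bs}"

definition type_of_blocks :: "block list \<Rightarrow> algebraic_type" where
  "type_of_blocks bs =
     \<lparr> jordan_sizes =
         image_mset (\<lambda>e. mset [k. Jordan e' k \<leftarrow> bs, e' = e]) (mset_set (block_eigenvalues bs)),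
       horizontal_indices = mset [h. Horizontal h \<leftarrow> bs],
       vertical_indices = mset [v. Vertical v \<leftarrow> bs] \<rparr>"

definition pencil_has_type ::
  "(complex \<Rightarrow> 'u::ab_group_add \<Rightarrow> 'u) \<Rightarrow> (complex \<Rightarrow> 'v::ab_group_add \<Rightarrow> 'v) \<Rightarrow>
   'u set \<Rightarrow> 'v set \<Rightarrow> ('u \<Rightarrow> 'v) \<Rightarrow> ('u \<Rightarrow> 'v) \<Rightarrow> algebraic_type \<Rightarrow> bool" where
  "pencil_has_type sU sV U V A B \<tau> \<longleftrightarrow>
     (\<exists>bs. has_Kronecker_form sU sV U V A B bs \<and> type_of_blocks bs = \<tau>)"


section \<open>Zariski open sets and Jordan--Kronecker invariants\<close>

text \<open>Polynomial functions on a vector space are generated by constants and linear functionals.\<close>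

inductive_set polynomial_functions ::
  "(complex \<Rightarrow> 'v::ab_group_add \<Rightarrow> 'v) \<Rightarrow> ('v \<Rightarrow> complex) set"
  for s :: "complex \<Rightarrow> 'v \<Rightarrow> 'v" where
  const: "(\<lambda>x. c) \<in> polynomial_functions s"
| linear: "Vector_Spaces.linear s (*) f \<Longrightarrow> f \<in> polynomial_functions s"
| add: "f \<in> polynomial_functions s \<Longrightarrow> g \<in> polynomial_functions s \<Longrightarrow>
    (\<lambda>x. f x + g x) \<in> polynomial_functions s"
| mult: "f \<in> polynomial_functions s \<Longrightarrow> g \<in> polynomial_functions s \<Longrightarrow>
    (\<lambda>x. f x * g x) \<in> polynomial_functions s"

text \<open>\<open>X\<close> is a subspace of the ambient space. Every polynomial function on \<open>X\<close> extends to the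
  ambient space, so it suffices to consider the latter.\<close>

definition Zariski_open_in ::
  "(complex \<Rightarrow> 'v::ab_group_add \<Rightarrow> 'v) \<Rightarrow> 'v set \<Rightarrow> 'v set \<Rightarrow> bool" where
  "Zariski_open_in s X Z \<longleftrightarrow>
     (\<exists>F \<subseteq> polynomial_functions s. Z = {x \<in> X. \<exists>f \<in> F. f x \<noteq> 0})"

text \<open>For \<open>\<rho> : \<gg> \<rightarrow> gl(W)\<close> the map \<open>R\<^sub>x\<close> is \<open>\<lambda>\<xi>. \<rho> \<xi> x\<close>. Since two non-empty Zariski open
  subsets of \<open>W \<times> W\<close> intersect and Kronecker blocks are unique up to permutation, there is exactly
  one \<open>\<tau>\<close> satisfying this predicate.\<close>

definition has_JK_invariants ::
  "(complex \<Rightarrow> 'g::ab_group_add \<Rightarrow> 'g) \<Rightarrow> (complex \<Rightarrow> 'w::ab_group_add \<Rightarrow> 'w) \<Rightarrow>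
   'g set \<Rightarrow> 'w set \<Rightarrow> ('g \<Rightarrow> 'w \<Rightarrow> 'w) \<Rightarrow> algebraic_type \<Rightarrow> bool" where
  "has_JK_invariants sg sW g W \<rho> \<tau> \<longleftrightarrow>
     (\<exists>Z. Zariski_open_in (module_prod.scale sW sW) (W \<times> W) Z \<and> Z \<noteq> {} \<and>
        (\<forall>(a, b) \<in> Z. pencil_has_type sg sW g W (\<lambda>\<xi>. \<rho> \<xi> a) (\<lambda>\<xi>. \<rho> \<xi> b) \<tau>))"


section \<open>The congruence representation of \<open>sl(V)\<close> on skew-symmetric forms\<close>

definition mat_scale :: "complex \<Rightarrow> complex^'n^'m \<Rightarrow> complex^'n^'m" where
  "mat_scale c = map_matrix ((*) c)"

definition sl :: "(complex^'n^'n) set" where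
  "sl = {X. trace X = 0}"

definition skew_forms :: "(complex^'n^'n) set" where
  "skew_forms = {Q. Finite_Cartesian_Product.transpose Q = - Q}"

definition congruence_rep :: "complex^'n^'n \<Rightarrow> complex^'n^'n \<Rightarrow> complex^'n^'n" where
  "congruence_rep X Q = X ** Q + Q ** Finite_Cartesian_Product.transpose X"

lemmas congruence_simps = mat_scale_def sl_def skew_forms_def congruence_rep_def
  map_matrix_def trace_def Finite_Cartesian_Product.transpose_def matrix_matrix_mult_def
  Finite_Cartesian_Product.vec_eq_iff

interpretation mat_space: vector_space mat_scale
  by unfold_locales (auto simp: congruence_simps algebra_simps)

lemma subspace_sl: "mat_space.subspace sl"
  by (auto simp: mat_space.subspace_def congruence_simps sum.distrib simp flip: sum_distrib_left)

lemma subspace_skew_forms: "mat_space.subspace (skew_forms :: (complex^'n^'n) set)"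
proof -
  have "Q \<in> skew_forms \<longleftrightarrow> (\<forall>i j. Q $ i $ j + Q $ j $ i = 0)" for Q :: "complex^'n^'n"
    by (simp add: skew_forms_def Finite_Cartesian_Product.transpose_def
        Finite_Cartesian_Product.vec_eq_iff eq_neg_iff_add_eq_0 add.commute)
  then show ?thesis
    by (auto simp: mat_space.subspace_def mat_scale_def algebra_simps
        simp flip: distrib_left)
qed

lemma linear_congruence_rep_left:
  "Vector_Spaces.linear mat_scale mat_scale (\<lambda>X. congruence_rep X Q)"
  by unfold_locales
    (auto simp: congruence_simps sum.distrib sum_distrib_left algebra_simps)

lemma linear_congruence_rep_right:
  "Vector_Spaces.linear mat_scale mat_scale (congruence_rep X)"
  by unfold_locales
    (auto simp: congruence_simps sum.distrib sum_distrib_left algebra_simps)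

lemma congruence_rep_skew_forms:
  fixes X Q :: "complex^'n^'n"
  assumes "Q \<in> skew_forms"
  shows "congruence_rep X Q \<in> skew_forms"
proof -
  have "Finite_Cartesian_Product.transpose (A + B) =
      Finite_Cartesian_Product.transpose A + Finite_Cartesian_Product.transpose B"
    and "X ** (- Q) = - (X ** Q)" and "(- Q) ** A = - (Q ** A)" for A B :: "complex^'n^'n"
    by (simp_all add: congruence_simps sum_negf)
  then show ?thesis
    using assms by (simp add: congruence_rep_def skew_forms_def matrix_transpose_mul)
qed

lemma congruence_rep_commutator:
  fixes X Y Q :: "complex^'n^'n"
  shows "congruence_rep (X ** Y - Y ** X) Q =
     congruence_rep X (congruence_rep Y Q) - congruence_rep Y (congruence_rep X Q)"
proof -
  have diff: "A ** (B - C) = A ** B - A ** C" "(B - C) ** A = B ** A - C ** A"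
    and add: "(B + C) ** A = B ** A + C ** A"
    for A B C :: "complex^'n^'n"
    by (simp_all add: congruence_simps sum_subtractf sum.distrib algebra_simps)
  have tr: "Finite_Cartesian_Product.transpose (A - B) =
      Finite_Cartesian_Product.transpose A - Finite_Cartesian_Product.transpose B"
    for A B :: "complex^'n^'n"
    by (simp add: congruence_simps)
  show ?thesis
    by (simp add: congruence_rep_def diff tr matrix_add_ldistrib add
        matrix_mul_assoc matrix_transpose_mul)
qed

end

theory Submission
  imports Defs "Jordan_Normal_Form.Schur_Decomposition"
begin

text \<open>For generic skew-symmetric \<open>a, b\<close> the matrix \<open>b\<close> is invertible and \<open>a - \<kappa> b\<close> is singular for
  \<open>n\<close> distinct values \<open>\<kappa>\<^sub>i\<close>. A singular skew-symmetric matrix of even size has a kernel of dimension at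
  least 2, so the kernels give a basis in which \<open>b\<close> is the direct sum of \<open>n\<close> blocks
  \<open>J = ((0, 1), (-1, 0))\<close> and \<open>a\<close> is the direct sum of the blocks \<open>\<kappa>\<^sub>i J\<close>. The pencil is equivariant
  under congruence, so only this standard pair matters. There the off-diagonal \<open>2 \<times> 2\<close> blocks of \<open>X\<close>
  split into \<open>2n(n - 1)\<close> pencils \<open>(x, y) \<mapsto> (\<kappa>\<^sub>j x - \<kappa>\<^sub>i y, x - y)\<close>, the traceless diagonal blocks are
  annihilated (\<open>3n\<close> zero columns), and the traces of the diagonal blocks, whose sum is 0, give the pencil
  \<open>t \<mapsto> (\<kappa> t, t)\<close>. The vector \<open>c\<^sub>i = 1 / \<Prod>\<^bsub>j \<noteq> i\<^esub> (\<kappa>\<^sub>i - \<kappa>\<^sub>j)\<close> satisfies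
  \<open>\<Sum>\<^sub>i c\<^sub>i \<kappa>\<^sub>i\<^sup>m = 0\<close> for \<open>m < n - 1\<close>, hence \<open>c, \<kappa> c, \<kappa>\<^sup>2 c, \<dots>\<close> is the basis that puts this pencil in the form of
  a vertical block of height \<open>n\<close>. The number of distinct \<open>\<kappa>\<^sub>i\<close> is controlled by the Hankel determinant
  of the power sums \<open>tr (adj(b) a)\<^sup>k\<close>.\<close>

no_notation Matrix.vec_index (infixl "$" 100)

section \<open>Lagrange interpolation\<close>

text \<open>Each \<open>c i\<close> is the leading coefficient of a Lagrange basis polynomial, so
  the interpolant of values s has coefficient \<Sum> s_i c_i at degree n - 1. The interpolant of x^j
  is x^j itself, whence the vanishing sums. The coefficients of the interpolant of t_i / c_i serve
  as \<open>g\<close>; its top coefficient is then the sum of \<open>t\<close>, which later ties the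
  missing top power to the trace condition.\<close>

lemma interpolation_weights:
  fixes \<kappa> :: "nat \<Rightarrow> complex"
  assumes inj: "inj_on \<kappa> {..<n}"
  obtains c where "\<And>i. i < n \<Longrightarrow> c i \<noteq> 0"
    and "\<And>j. j + 1 < n \<Longrightarrow> (\<Sum>i<n. c i * \<kappa> i ^ j) = 0"
    and "\<And>t. \<exists>g. (\<forall>i<n. t i = (\<Sum>j<n. g j * (c i * \<kappa> i ^ j))) \<and> g (n - 1) = (\<Sum>i<n. t i)"
proof -
  define c where "c i = inverse (\<Prod>j\<in>{..<n} - {i}. \<kappa> i - \<kappa> j)" for i
  \<comment> \<open>The Lagrange basis polynomial: 1 at its own node and 0 at the others.
    \<open>G t\<close> below is the interpolant of \<open>t\<close>.\<close>
  define L where "L i = Polynomial.smult (c i) (\<Prod>j\<in>{..<n} - {i}. [:- \<kappa> j, 1:])" for i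
  have c0: "c i \<noteq> 0" if "i < n" for i
    using that inj by (auto simp: c_def inj_on_def)
  have monic: "lead_coeff (\<Prod>j\<in>A. [:- \<kappa> j, 1:]) = 1"
    and degA: "degree (\<Prod>j\<in>A. [:- \<kappa> j, 1:]) = card A" if "finite A" for A
  proof -
    show "lead_coeff (\<Prod>j\<in>A. [:- \<kappa> j, 1:]) = 1" by (simp add: lead_coeff_prod)
    show "degree (\<Prod>j\<in>A. [:- \<kappa> j, 1:]) = card A" by (simp add: degree_prod_eq_sum_degree)
  qed
  have deg: "degree (L i) = n - 1" and lead: "coeff (L i) (n - 1) = c i" if "i < n" for i
    using degA[of "{..<n} - {i}"] monic[of "{..<n} - {i}"] that c0[OF that] by (auto simp: L_def)
  have L: "poly (L i) (\<kappa> l) = (if i = l then 1 else 0)" if "i < n" "l < n" for i l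
  proof (cases "i = l")
    case True
    then show ?thesis using that c0[OF that(1)] by (auto simp: L_def poly_prod c_def)
  next
    case False
    then have "(\<Prod>j\<in>{..<n} - {i}. poly [:- \<kappa> j, 1:] (\<kappa> l)) = 0"
      using that by (intro prod_zero) auto
    then show ?thesis using False by (simp add: L_def poly_prod)
  qed
  define G where "G t = (\<Sum>i<n. Polynomial.smult (t i) (L i))" for t
  have degG: "degree (G t) \<le> n - 1" for t
    unfolding G_def by (intro degree_sum_le) (auto intro!: order.trans[OF Polynomial.degree_smult_le] simp: deg)
  have polyG: "poly (G t) (\<kappa> l) = t l" if "l < n" for t l
  proof -
    have "poly (G t) (\<kappa> l) = (\<Sum>i<n. if i = l then t i else 0)"
      unfolding G_def poly_sum using that by (intro sum.cong) (auto simp: L)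
    then show ?thesis using that by simp
  qed
  have coeffG: "coeff (G t) (n - 1) = (\<Sum>i<n. t i * c i)" for t
    unfolding G_def coeff_sum by (intro sum.cong) (auto simp: lead simp del: One_nat_def)
  have card: "card (\<kappa> ` {..<n}) = n" using inj by (simp add: card_image)
  have zero: "(\<Sum>i<n. c i * \<kappa> i ^ j) = 0" if "j + 1 < n" for j
  proof -
    \<comment> \<open>Both sides have degree below n and agree at n nodes.\<close>
    have "G (\<lambda>i. \<kappa> i ^ j) = monom 1 j"
      using degG[of "\<lambda>i. \<kappa> i ^ j"] that
      by (intro poly_eqI_degree[of "\<kappa> ` {..<n}"])
        (auto simp: polyG card poly_monom degree_monom_eq)
    then have "coeff (monom 1 j) (n - 1) = (\<Sum>i<n. \<kappa> i ^ j * c i)" using coeffG by metis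
    then show ?thesis using that by (cases "j = n - 1") (auto simp: mult.commute)
  qed
  have ex: "\<exists>g. (\<forall>i<n. t i = (\<Sum>j<n. g j * (c i * \<kappa> i ^ j))) \<and> g (n - 1) = (\<Sum>i<n. t i)" for t
  proof (intro exI conjI allI impI)
    let ?G = "G (\<lambda>i. t i / c i)"
    fix i assume i: "i < n"
    have "t i = c i * poly ?G (\<kappa> i)" using i c0 by (simp add: polyG)
    also have "poly ?G (\<kappa> i) = (\<Sum>j\<le>n-1. coeff ?G j * \<kappa> i ^ j)"
      by (subst poly_as_sum_of_monoms'[OF degG, symmetric]) (simp add: poly_sum poly_monom)
    also have "{..n-1} = {..<n}" using i by auto
    finally show "t i = (\<Sum>j<n. coeff ?G j * (c i * \<kappa> i ^ j))"
      by (simp add: sum_distrib_left algebra_simps)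
  next
    show "coeff (G (\<lambda>i. t i / c i)) (n - 1) = (\<Sum>i<n. t i)"
      unfolding coeffG using c0 by (intro sum.cong) auto
  qed
  show thesis by (rule that[OF c0 zero ex])
qed

section \<open>Independence and bases\<close>

text \<open>Applying \<open>\<phi> i\<close> to a vanishing combination isolates the coefficient of
  \<open>v i\<close>. This provides the lower bounds for the dimensions of \<open>sl\<close> and
  \<open>skew_forms\<close>.\<close>

lemma (in vector_space) independent_dual_family:
  assumes "finite I" "\<And>i j. i \<in> I \<Longrightarrow> j \<in> I \<Longrightarrow> \<phi> i (v j) = (if i = j then 1 else (0::'a))"
    and add: "\<And>i x y. i \<in> I \<Longrightarrow> \<phi> i (x + y) = \<phi> i x + \<phi> i y"
    and scale: "\<And>i c x. i \<in> I \<Longrightarrow> \<phi> i (scale c x) = c * \<phi> i x"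
  shows "independent (v ` I)" and "card (v ` I) = card I"
proof -
  have inj: "inj_on v I"
    using assms(2) by (metis inj_onI zero_neq_one)
  then show "card (v ` I) = card I" by (rule card_image)
  have zero: "\<phi> i 0 = 0" if "i \<in> I" for i using scale[OF that, of 0 0] by simp
  have sum: "\<phi> i (\<Sum>x\<in>A. f x) = (\<Sum>x\<in>A. \<phi> i (f x))" if "i \<in> I" for i A and f :: "_ \<Rightarrow> 'b"
    by (induction A rule: infinite_finite_induct) (auto simp: zero add that)
  have "u (v i) = 0" if "(\<Sum>x\<in>v ` I. scale (u x) x) = 0" "i \<in> I" for u i
  proof -
    have "0 = \<phi> i (\<Sum>j\<in>I. scale (u (v j)) (v j))"
      using that zero inj by (simp add: sum.reindex)
    also have "\<dots> = (\<Sum>j\<in>I. if i = j then u (v j) else 0)"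
      unfolding sum[OF that(2)] using that(2) assms(2) by (intro sum.cong) (auto simp: scale)
    finally show ?thesis using that assms(1) by simp
  qed
  then show "independent (v ` I)"
    by (subst dependent_finite) (use assms(1) in auto)
qed

text \<open>A repeated or dependent member of \<open>us\<close> could be dropped, leaving a spanning
  set smaller than the independent set \<open>B\<close>, against the exchange lemma. So a candidate
  basis only has to span and to have the right length.\<close>

lemma (in vector_space) independent_if_span_large:
  assumes B: "independent B" "B \<subseteq> span (set us)" "length us \<le> card B"
  shows "independent (set us)" and "distinct us"
proof -
  have bound: "card B \<le> card T" if "finite T" "span (set us) \<subseteq> span T" for T
    using independent_span_bound[of T B] B that by auto
  have "card B \<le> card (set us)" by (rule bound) auto
  then show "distinct us"
    using B(3) card_length[of us] by (intro card_distinct) linarith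
  show "independent (set us)"
  proof
    assume "dependent (set us)"
    then obtain x where x: "x \<in> set us" "x \<in> span (set us - {x})" by (auto simp: dependent_def)
    then have "span (set us) \<subseteq> span (set us - {x})"
      by (intro span_minimal subspace_span subsetI) (metis DiffI singletonD span_base)
    then have "card B \<le> card (set us - {x})" by (intro bound) auto
    moreover have "card (set us - {x}) < card (set us)" using x by (intro psubset_card_mono) auto
    ultimately show False using B(3) card_length[of us] by linarith
  qed
qed

section \<open>Assembling and transporting Kronecker forms\<close>

lemma matrix_represents_append:
  fixes s :: "complex \<Rightarrow> 'v::ab_group_add \<Rightarrow> 'v"
  assumes s: "vector_space s"
    and 1: "matrix_represents s us vs M f" and 2: "matrix_represents s us' vs' M' f"
  shows "matrix_represents s (us @ us') (vs @ vs')
    (four_block_mat M (0\<^sub>m (dim_row M) (dim_col M')) (0\<^sub>m (dim_row M') (dim_col M)) M') f"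
proof -
  interpret vector_space s by (rule s)
  note dims = 1[unfolded matrix_represents_def] 2[unfolded matrix_represents_def]
  have d: "dim_row M = length vs" "dim_col M = length us" "dim_row M' = length vs'" "dim_col M' = length us'"
    using dims by auto
  have split: "(\<Sum>i<length (vs @ vs'). g i) = (\<Sum>i<length vs. g i) + (\<Sum>i<length vs'. g (length vs + i))"
    for g :: "nat \<Rightarrow> 'v"
    using sum.atLeastLessThan_concat[of 0 "length vs" "length vs + length vs'" g]
      sum.shift_bounds_nat_ivl[of g 0 "length vs" "length vs'"]
    by (simp add: lessThan_atLeast0 add.commute)
  let ?N = "four_block_mat M (0\<^sub>m (dim_row M) (dim_col M')) (0\<^sub>m (dim_row M') (dim_col M)) M'"
  have "f ((us @ us') ! j) = (\<Sum>i<length (vs @ vs'). s (?N $$ (i, j)) ((vs @ vs') ! i))"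
    if "j < length (us @ us')" for j
  proof (cases "j < length us")
    case True
    then show ?thesis unfolding split using dims d by (simp add: nth_append)
  next
    case False
    then show ?thesis unfolding split using dims d that by (simp add: nth_append)
  qed
  then show ?thesis
    unfolding matrix_represents_def using d by auto
qed

text \<open>Lets the blocks of a Kronecker form be verified one at a time. Empty lists are allowed,
  so a zero column is a block with one source vector and no target vector.\<close>

lemma matrix_represents_concat:
  assumes s: "vector_space s" and "\<And>t. t \<in> set ts \<Longrightarrow> matrix_represents s (us t) (vs t) (M t) f"
  shows "matrix_represents s (concat (map us ts)) (concat (map vs ts)) (diag_block_mat (map M ts)) f"
  using assms(2)
proof (induction ts)
  case Nil
  then show ?case by (simp add: matrix_represents_def)
next
  case (Cons t ts)
  then show ?case using matrix_represents_append[OF s, of "us t" "vs t" "M t" f]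
    by (simp add: Let_def)
qed

lemma ordered_basis_image:
  assumes lin: "Vector_Spaces.linear s s' \<phi>" and inj: "inj_on \<phi> U" and us: "ordered_basis s U us"
  shows "ordered_basis s' (\<phi> ` U) (map \<phi> us)"
proof -
  interpret Vector_Spaces.linear s s' \<phi> by (rule lin)
  have U: "vs1.span (set us) = U" "set us \<subseteq> U"
    using us by (auto simp: ordered_basis_def vs1.span_base)
  then show ?thesis
    using us inj independent_injective_image[of "set us"] span_image[of "set us"]
    by (auto simp: ordered_basis_def distinct_map intro: inj_on_subset)
qed

lemma matrix_represents_image:
  assumes lin: "Vector_Spaces.linear s s' \<psi>"
    and f: "\<And>x. x \<in> set us \<Longrightarrow> f' (\<phi> x) = \<psi> (f x)" and M: "matrix_represents s us vs M f"
  shows "matrix_represents s' (map \<phi> us) (map \<psi> vs) M f'"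
proof -
  interpret Vector_Spaces.linear s s' \<psi> by (rule lin)
  show ?thesis using M f by (auto simp: matrix_represents_def sum scale)
qed

text \<open>Strict equivalence of pencils: the bases are moved along \<open>\<phi>\<close> and
  \<open>\<psi>\<close>, and the matrices stay the same.\<close>

lemma has_Kronecker_form_transport:
  assumes \<phi>: "Vector_Spaces.linear sU sU' \<phi>" "inj_on \<phi> U" and \<psi>: "Vector_Spaces.linear sV sV' \<psi>" "inj_on \<psi> V"
    and A: "\<And>x. x \<in> U \<Longrightarrow> A' (\<phi> x) = \<psi> (A x)" and B: "\<And>x. x \<in> U \<Longrightarrow> B' (\<phi> x) = \<psi> (B x)"
    and K: "has_Kronecker_form sU sV U V A B bs"
  shows "has_Kronecker_form sU' sV' (\<phi> ` U) (\<psi> ` V) A' B' bs"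
proof -
  obtain us vs where K': "\<forall>b \<in> set bs. proper_block b" "ordered_basis sU U us" "ordered_basis sV V vs"
     "matrix_represents sV us vs (diag_block_mat (map block_A bs)) A"
     "matrix_represents sV us vs (diag_block_mat (map block_B bs)) B"
    using K by (auto simp: has_Kronecker_form_def)
  interpret \<phi>: Vector_Spaces.linear sU sU' \<phi> by (rule \<phi>)
  have "set us \<subseteq> U" using K'(2) by (auto simp: ordered_basis_def \<phi>.vs1.span_base)
  then have "matrix_represents sV' (map \<phi> us) (map \<psi> vs) (diag_block_mat (map block_A bs)) A'"
      "matrix_represents sV' (map \<phi> us) (map \<psi> vs) (diag_block_mat (map block_B bs)) B'"
    using A B by (intro matrix_represents_image[OF \<psi>(1) _ K'(4)] matrix_represents_image[OF \<psi>(1) _ K'(5)]; auto)+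
  then show ?thesis
    using K'(1) ordered_basis_image[OF \<phi> K'(2)] ordered_basis_image[OF \<psi> K'(3)]
    by (auto simp: has_Kronecker_form_def)
qed

section \<open>Matrix units\<close>

lemma matrix_represents_Horizontal_1:
  assumes "f z = 0"
  shows "matrix_represents s [z] [] (shift_right 1) f" "matrix_represents s [z] [] (shift_left 1) f"
  using assms by (simp_all add: matrix_represents_def shift_right_def shift_left_def)

lemma matrix_represents_Horizontal_2:
  assumes "vector_space s"
  shows "f u0 = 0 \<Longrightarrow> f u1 = v \<Longrightarrow> matrix_represents s [u0, u1] [v] (shift_right 2) f"
    and "f u0 = v \<Longrightarrow> f u1 = 0 \<Longrightarrow> matrix_represents s [u0, u1] [v] (shift_left 2) f"
proof -
  interpret vector_space s by (rule assms)
  show "f u0 = 0 \<Longrightarrow> f u1 = v \<Longrightarrow> matrix_represents s [u0, u1] [v] (shift_right 2) f"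
    and "f u0 = v \<Longrightarrow> f u1 = 0 \<Longrightarrow> matrix_represents s [u0, u1] [v] (shift_left 2) f"
    by (auto simp: matrix_represents_def shift_right_def shift_left_def less_Suc_eq)
qed

lemma matrix_represents_Vertical:
  assumes "vector_space s"
  shows "(\<And>j. j + 1 < m \<Longrightarrow> f (u j) = v (j + 1)) \<Longrightarrow>
      matrix_represents s (map u [0..<m - 1]) (map v [0..<m]) (transpose_mat (shift_right m)) f"
    and "(\<And>j. j + 1 < m \<Longrightarrow> f (u j) = v j) \<Longrightarrow>
      matrix_represents s (map u [0..<m - 1]) (map v [0..<m]) (transpose_mat (shift_left m)) f"
proof -
  interpret vector_space s by (rule assms)
  \<comment> \<open>Every column of the two shift matrices has a single 1, so the image of a basis
    vector is a single basis vector.\<close>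
  have delta: "(\<Sum>i<m. s (M $$ (i, j)) (map v [0..<m] ! i)) = v l"
    if "l < m" "\<And>i. i < m \<Longrightarrow> M $$ (i, j) = (if i = l then 1 else 0)" for l j M
  proof -
    have "(\<Sum>i<m. s (M $$ (i, j)) (map v [0..<m] ! i)) = (\<Sum>i<m. if i = l then v i else 0)"
      by (intro sum.cong) (auto simp: that)
    then show ?thesis using that by simp
  qed
  have R: "transpose_mat (shift_right m) $$ (i, j) = (if i = j + 1 then 1 else 0)"
    and L: "transpose_mat (shift_left m) $$ (i, j) = (if i = j then 1 else 0)" if "i < m" "j < m - 1" for i j
    using that by (auto simp: shift_right_def shift_left_def)
  have dim: "transpose_mat (shift_right m) \<in> carrier_mat m (m - 1)"
    "transpose_mat (shift_left m) \<in> carrier_mat m (m - 1)"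
    by (auto simp: shift_right_def shift_left_def)
  show "matrix_represents s (map u [0..<m - 1]) (map v [0..<m]) (transpose_mat (shift_right m)) f"
    if "\<And>j. j + 1 < m \<Longrightarrow> f (u j) = v (j + 1)"
    unfolding matrix_represents_def
  proof (intro conjI allI impI)
    fix j assume "j < length (map u [0..<m - 1])"
    then have j: "j + 1 < m" "j < m - 1" by auto
    then show "f (map u [0..<m - 1] ! j) =
      (\<Sum>i<length (map v [0..<m]). s (transpose_mat (shift_right m) $$ (i, j)) (map v [0..<m] ! i))"
      using that[OF j(1)] delta[OF j(1) R] by simp
  qed (use dim in auto)
  show "matrix_represents s (map u [0..<m - 1]) (map v [0..<m]) (transpose_mat (shift_left m)) f"
    if "\<And>j. j + 1 < m \<Longrightarrow> f (u j) = v j"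
    unfolding matrix_represents_def
  proof (intro conjI allI impI)
    fix j assume "j < length (map u [0..<m - 1])"
    then have j: "j + 1 < m" "j < m" "j < m - 1" by auto
    then show "f (map u [0..<m - 1] ! j) =
      (\<Sum>i<length (map v [0..<m]). s (transpose_mat (shift_left m) $$ (i, j)) (map v [0..<m] ! i))"
      using that[OF j(1)] delta[OF j(2) L] by simp
  qed (use dim in auto)
qed

section \<open>Units of gl and of the skew-symmetric matrices\<close>

definition matrix_unit :: "'n \<Rightarrow> 'n \<Rightarrow> complex^'n^'n" where
  "matrix_unit p q = (\<chi> i j. if i = p \<and> j = q then 1 else 0)"

definition skew_unit :: "'n \<Rightarrow> 'n \<Rightarrow> complex^'n^'n" where
  "skew_unit p q = matrix_unit p q - matrix_unit q p"

lemma matrix_unit_nth [simp]: "matrix_unit p q $ i $ j = (if i = p \<and> j = q then 1 else 0)"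
  by (simp add: matrix_unit_def)

lemma mat_scale_nth [simp]: "mat_scale c A $ i $ j = c * A $ i $ j"
  by (simp add: mat_scale_def map_matrix_def)

lemma mat_eqI: "(\<And>i j. A $ i $ j = B $ i $ j) \<Longrightarrow> A = (B :: 'a^'n^'m)"
  by (simp add: Finite_Cartesian_Product.vec_eq_iff)

lemma sum_nth2: "(\<Sum>x\<in>A. f x) $ i $ j = (\<Sum>x\<in>A. f x $ i $ j)"
  by (simp add: sum_component)

lemma matrix_unit_expansion:
  fixes X :: "complex^'n^'n"
  shows "X = (\<Sum>p\<in>UNIV. \<Sum>q\<in>UNIV. mat_scale (X $ p $ q) (matrix_unit p q))"
proof (rule mat_eqI)
  fix i j
  have "(\<Sum>q\<in>UNIV. X $ p $ q * (if i = p \<and> j = q then 1 else 0)) = (if i = p then X $ p $ j else 0)" for p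
  proof -
    have "(\<Sum>q\<in>UNIV. X $ p $ q * (if i = p \<and> j = q then 1 else 0)) =
        (\<Sum>q\<in>UNIV. if j = q then (if i = p then X $ p $ j else 0) else 0)"
      by (intro sum.cong) auto
    then show ?thesis by simp
  qed
  then have "X $ i $ j = (\<Sum>p\<in>UNIV. \<Sum>q\<in>UNIV. X $ p $ q * (if i = p \<and> j = q then 1 else 0))"
    by simp
  then show "X $ i $ j = (\<Sum>p\<in>UNIV. \<Sum>q\<in>UNIV. mat_scale (X $ p $ q) (matrix_unit p q)) $ i $ j"
    by (simp only: sum_nth2 mat_scale_nth matrix_unit_nth)
qed

lemma skew_forms_iff: "Q \<in> skew_forms \<longleftrightarrow> (\<forall>i j. Q $ i $ j = - (Q $ j $ i))"
  unfolding skew_forms_def Finite_Cartesian_Product.vec_eq_iff Finite_Cartesian_Product.transpose_def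
    mem_Collect_eq vec_lambda_beta vector_uminus_component by blast

text \<open>An unordered pair of indices occurs twice in the double sum, with equal contributions,
  hence the factor 1/2. This form avoids an order on the index type.\<close>

lemma skew_unit_expansion:
  fixes Q :: "complex^'n^'n"
  assumes "Q \<in> skew_forms"
  shows "Q = (\<Sum>p\<in>UNIV. \<Sum>q\<in>UNIV. mat_scale (Q $ p $ q / 2) (skew_unit p q))"
proof -
  have eq: "mat_scale (Q $ p $ q / 2) (skew_unit p q) = mat_scale (1 / 2) (mat_scale (Q $ p $ q) (matrix_unit p q)) +
       mat_scale (1 / 2) (mat_scale (Q $ q $ p) (matrix_unit q p))" for p q
  proof -
    have "Q $ q $ p = - (Q $ p $ q)" using assms unfolding skew_forms_iff by blast
    then show ?thesis by (simp only:) (rule mat_eqI, simp add: skew_unit_def right_diff_distrib)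
  qed
  have swap: "(\<Sum>p\<in>UNIV. \<Sum>q\<in>UNIV. mat_scale (1 / 2) (mat_scale (Q $ q $ p) (matrix_unit q p))) = 
    (\<Sum>p\<in>UNIV. \<Sum>q\<in>UNIV. mat_scale (1 / 2) (mat_scale (Q $ p $ q) (matrix_unit p q)))"
    by (rule sum.swap)
  have "(\<Sum>p\<in>UNIV. \<Sum>q\<in>UNIV. mat_scale (Q $ p $ q / 2) (skew_unit p q)) = mat_scale (1/2) Q + mat_scale (1/2) Q"
    unfolding eq sum.distrib swap
    by (simp only: mat_space.scale_sum_right[symmetric] matrix_unit_expansion[of Q, symmetric])
  then show ?thesis by (simp add: mat_space.scale_left_distrib[symmetric])
qed

lemma sl_iff: "X \<in> sl \<longleftrightarrow> (\<Sum>i\<in>UNIV. X $ i $ i) = 0"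
  by (simp add: sl_def trace_def)

lemma trace_matrix_unit: "(\<Sum>i\<in>UNIV. matrix_unit p q $ i $ i) = (if p = q then 1 else 0)"
proof -
  have "(\<Sum>i\<in>UNIV. matrix_unit p q $ i $ i) = (\<Sum>i\<in>UNIV. if i = p then (if p = q then 1 else 0) else 0)"
    by (intro sum.cong) auto
  then show ?thesis by simp
qed

text \<open>All matrix units except the one at an arbitrary diagonal position
  \<open>(p0, p0)\<close>, which is subtracted from the other diagonal units to make them traceless.
  The dual functionals are the remaining entries, and they do not see this correction.\<close>

lemma sl_independent_set:
  obtains B where "mat_space.independent B" "B \<subseteq> (sl :: (complex^'n^'n) set)" "card B = CARD('n::finite)\<^sup>2 - 1"
proof -
  obtain p0 :: 'n where True by simp
  define I where "I = UNIV - {(p0, p0)}"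
  define v where "v = (\<lambda>(p, q). matrix_unit p q - (if p = q then matrix_unit p0 p0 else 0))"
  have "mat_space.independent (v ` I)" "card (v ` I) = card I"
    by (rule mat_space.independent_dual_family[of I "\<lambda>(p, q) X. X $ p $ q"];
        auto simp: I_def v_def split: if_splits)+
  moreover have "v ` I \<subseteq> sl"
    by (auto simp: v_def sl_iff sum_subtractf trace_matrix_unit)
  moreover have "card I = CARD('n)\<^sup>2 - 1"
    by (simp add: I_def card_Diff_subset power2_eq_square)
  ultimately show thesis using that by metis
qed

section \<open>The standard pair\<close>

text \<open>The index type is an arbitrary finite type with 2n elements. The numbering
  \<open>e\<close> makes it a union of n pairs, the members of a pair having numbers i and i +
  n.\<close>

locale paired_enumeration =
  fixes n :: nat and e :: "nat \<Rightarrow> 'n::finite"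
  assumes bij: "bij_betw e {..<2 * n} UNIV"
begin

definition idx :: "'n \<Rightarrow> nat" where
  "idx = the_inv_into {..<2 * n} e"

definition partner :: "'n \<Rightarrow> 'n" where
  "partner p = e (if idx p < n then idx p + n else idx p - n)"

definition sgn_of :: "'n \<Rightarrow> complex" where
  "sgn_of p = (if idx p < n then 1 else - 1)"

text \<open>The direct sum of the blocks \<kappa>_i J over the pairs; for constant value 1 it is the
  standard symplectic matrix.\<close>

definition std_form :: "(nat \<Rightarrow> complex) \<Rightarrow> complex^'n^'n" where
  "std_form \<kappa> = (\<chi> p q. if q = partner p then \<kappa> (idx p mod n) * sgn_of p else 0)"

lemma idx_less [simp]: "idx p < 2 * n"
  and e_idx [simp]: "e (idx p) = p"
  using bij the_inv_into_into[of e "{..<2 * n}" p] f_the_inv_into_f_bij_betw[OF bij]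
  by (auto simp: idx_def bij_betw_def)

lemma idx_e [simp]: "i < 2 * n \<Longrightarrow> idx (e i) = i"
  unfolding idx_def using bij by (intro the_inv_into_f_f) (auto simp: bij_betw_def)

lemma idx_partner: "idx (partner p) = (if idx p < n then idx p + n else idx p - n)"
proof -
  have "(if idx p < n then idx p + n else idx p - n) < 2 * n" using idx_less[of p] by (auto simp del: idx_less)
  then show ?thesis unfolding partner_def by (rule idx_e)
qed

lemma partner_partner [simp]: "partner (partner p) = p"
proof -
  have "(if idx (partner p) < n then idx (partner p) + n else idx (partner p) - n) = idx p"
    using idx_less[of p] by (auto simp: idx_partner simp del: idx_less)
  then show ?thesis unfolding partner_def[of "partner p"] by simp
qed

lemma partner_neq [simp]: "partner p \<noteq> p" "p \<noteq> partner p"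
proof -
  have "n > 0" using idx_less[of p] by linarith
  then show "partner p \<noteq> p" using idx_partner[of p] by (metis diff_less less_irrefl
    less_add_same_cancel1 not_less order_less_le_trans)
  then show "p \<noteq> partner p" by metis
qed

lemma partner_e: "i < n \<Longrightarrow> partner (e i) = e (i + n)"
  by (simp add: partner_def)

lemma partner_eq_iff: "partner p = partner q \<longleftrightarrow> p = q" "p = partner q \<longleftrightarrow> q = partner p"
  by (metis partner_partner)+

lemma sgn_of_partner [simp]: "sgn_of (partner p) = - sgn_of p"
  using idx_less[of p] by (auto simp: sgn_of_def idx_partner simp del: idx_less)

lemma sgn_of_square [simp]: "sgn_of p * sgn_of p = 1"
  by (simp add: sgn_of_def)

lemma sgn_of_neq_0 [simp]: "sgn_of p \<noteq> 0"
  by (simp add: sgn_of_def)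

lemma idx_mod: "idx p mod n = (if idx p < n then idx p else idx p - n)"
  using idx_less[of p] by (auto simp: le_mod_geq simp del: idx_less)

lemma mod_idx_partner [simp]: "idx (partner p) mod n = idx p mod n"
  using idx_less[of p] by (auto simp: idx_partner idx_mod simp del: idx_less)

text \<open>The residue \<open>idx p mod n\<close> thus serves as the number of the pair containing
  \<open>p\<close>.\<close>

lemma mod_idx_eq_iff: "idx p mod n = idx q mod n \<longleftrightarrow> p = q \<or> p = partner q"
proof
  have "idx p = idx q \<or> idx p = idx (partner q)" if "idx p mod n = idx q mod n"
    using that idx_less[of p] idx_less[of q] by (auto simp: idx_partner idx_mod simp del: idx_less split: if_splits)
  then show "p = q \<or> p = partner q" if "idx p mod n = idx q mod n"
    using that by (metis e_idx)
qed auto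

lemma card_UNIV_eq: "CARD('n) = 2 * n"
  using bij_betw_same_card[OF bij] by simp

lemma sum_UNIV_paired: "(\<Sum>p\<in>UNIV. f p) = (\<Sum>i<n. f (e i) + f (partner (e i)))"
proof -
  have "(\<Sum>p\<in>UNIV. f p) = (\<Sum>i<2 * n. f (e i))"
    by (rule sum.reindex_bij_betw[OF bij, symmetric])
  also have "\<dots> = (\<Sum>i<n. f (e i)) + (\<Sum>i<n. f (e (i + n)))"
    using sum.atLeastLessThan_concat[of 0 n "n + n" "\<lambda>i. f (e i)"]
      sum.shift_bounds_nat_ivl[of "\<lambda>i. f (e i)" 0 n n]
    by (simp add: lessThan_atLeast0 mult_2)
  finally show ?thesis by (simp add: sum.distrib partner_e)
qed

text \<open>The factor makes \<open>std_form (\<lambda>_. 1)\<close> send \<open>gl_unit p r\<close> to \<open>skew_unit p r\<close>.\<close>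

definition gl_unit :: "'n \<Rightarrow> 'n \<Rightarrow> complex^'n^'n" where
  "gl_unit p r = mat_scale (- sgn_of r) (matrix_unit p (partner r))"

text \<open>A row or column of \<open>std_form \<kappa>\<close> has at most one non-zero entry, so
  each matrix product collapses to one term. The minus sign is the sign of \<open>partner j\<close>
  relative to \<open>j\<close>.\<close>

lemma congruence_std_form_nth:
  "congruence_rep X (std_form \<kappa>) $ i $ j =
     X $ j $ partner i * (\<kappa> (idx i mod n) * sgn_of i) - X $ i $ partner j * (\<kappa> (idx j mod n) * sgn_of j)"
proof -
  have "(X ** std_form \<kappa>) $ i $ j = (\<Sum>k\<in>UNIV. if k = partner j then X $ i $ k * (\<kappa> (idx k mod n) * sgn_of k) else 0)"
    unfolding matrix_matrix_mult_def vec_lambda_beta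
    by (intro sum.cong) (auto simp: std_form_def partner_eq_iff)
  moreover have "(std_form \<kappa> ** Finite_Cartesian_Product.transpose X) $ i $ j =
      (\<Sum>k\<in>UNIV. if k = partner i then X $ j $ k * (\<kappa> (idx i mod n) * sgn_of i) else 0)"
    unfolding matrix_matrix_mult_def vec_lambda_beta
    by (intro sum.cong) (auto simp: std_form_def Finite_Cartesian_Product.transpose_def)
  ultimately show ?thesis
    by (simp add: congruence_rep_def)
qed

text \<open>The images of \<open>gl_unit p r\<close> and \<open>gl_unit r p\<close> lie on one line,
  since \<open>skew_unit r p = - skew_unit p r\<close>, but their scalars belong to \<open>r\<close>
  and \<open>p\<close> respectively. For indices from different pairs this yields a block of width
  2; within a pair the scalars agree and kernel vectors arise.\<close>

lemma congruence_gl_unit: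
  "congruence_rep (gl_unit p r) (std_form \<kappa>) = mat_scale (\<kappa> (idx r mod n)) (skew_unit p r)"
proof (rule mat_eqI)
  fix i j
  have entry: "- sgn_of r * (if j = p \<and> i = r then 1 else 0) * (\<kappa> (idx i mod n) * sgn_of i) =
      - \<kappa> (idx r mod n) * (if j = p \<and> i = r then 1 else 0)" for i j
  proof (cases "j = p \<and> i = r")
    case True
    then have "i = r" by simp
    then show ?thesis by (simp add: sgn_of_def)
  next
    case False
    then show ?thesis by (simp only: if_False mult_zero_right mult_zero_left)
  qed
  show "congruence_rep (gl_unit p r) (std_form \<kappa>) $ i $ j =
      mat_scale (\<kappa> (idx r mod n)) (skew_unit p r) $ i $ j"
    unfolding congruence_std_form_nth gl_unit_def skew_unit_def mat_scale_nth matrix_unit_nth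
      vector_minus_component partner_eq_iff(1) entry
    by (simp only: conj_commute minus_mult_left[symmetric] right_diff_distrib) simp
qed

lemma matrix_unit_eq_gl_unit: "matrix_unit p q = mat_scale (sgn_of q) (gl_unit p (partner q))"
  by (simp add: gl_unit_def)

lemma matrix_unit_diag: "i < n \<Longrightarrow> matrix_unit (e i) (e i) = gl_unit (e i) (partner (e i))"
  using matrix_unit_eq_gl_unit[of "e i" "e i"] by (simp add: sgn_of_def)

interpretation L: Vector_Spaces.linear mat_scale mat_scale "\<lambda>X. congruence_rep X Q" for Q :: "complex^'n^'n"
  by (rule linear_congruence_rep_left)

section \<open>Counting and spanning in the two spaces\<close>

text \<open>One element for each block of width 2. The omitted positions \<open>j = i + n\<close>
  carry the vertical block.\<close>

definition unpaired :: "(nat \<times> nat) set" where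
  "unpaired = {(i, j). i < j \<and> j < 2 * n \<and> j \<noteq> i + n}"

lemma card_unpaired: "finite unpaired" "card unpaired = 2 * n * (n - 1)"
proof -
  \<comment> \<open>Grouped by the larger index j, whose partner lies below it exactly when n \<le>
    j.\<close>
  have eq: "unpaired = prod.swap ` (SIGMA j:{..<2 * n}. {..<j} - (if n \<le> j then {j - n} else {}))"
    by (auto simp: unpaired_def image_iff split: if_splits)
  show "finite unpaired" unfolding eq by (intro finite_imageI finite_SigmaI) auto
  have "card unpaired = (\<Sum>j<2 * n. j - (if n \<le> j then 1 else 0))"
    unfolding eq by (subst card_image) (auto simp: card_Diff_subset intro!: sum.cong)
  also have "\<dots> = (\<Sum>j<n. j) + (\<Sum>j<n. n + j - 1)"
    using sum.atLeastLessThan_concat[of 0 n "n + n" "\<lambda>j. j - (if n \<le> j then 1 else 0)"]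
      sum.shift_bounds_nat_ivl[of "\<lambda>j. j - (if n \<le> j then 1 else 0)" 0 n n]
    by (simp add: lessThan_atLeast0 mult_2 add.commute)
  also have "(\<Sum>j<n. n + j - 1) = (\<Sum>j<n. (n - 1) + j)"
    by (intro sum.cong) auto
  also have "\<dots> = n * (n - 1) + (\<Sum>j<n. j)"
    by (simp only: sum.distrib sum_constant card_lessThan of_nat_id)
  also have "(\<Sum>j<n. j) + (n * (n - 1) + (\<Sum>j<n. j)) = n * (n - 1) + 2 * (\<Sum>j<n. j)" by simp
  also have "2 * (\<Sum>j<n. j) = n * (n - 1)"
  proof (induction n)
    case (Suc m)
    then show ?case by (cases m) auto
  qed simp
  finally show "card unpaired = 2 * n * (n - 1)" by simp
qed

lemma skew_unit_in_skew_forms: "skew_unit p q \<in> skew_forms"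
  unfolding skew_forms_iff skew_unit_def by (simp add: conj_commute)

lemma skew_independent_set:
  obtains B where "mat_space.independent B" "B \<subseteq> (skew_forms :: (complex^'n^'n) set)" "card B = n * (2 * n - 1)"
proof -
  define I where "I = prod.swap ` (SIGMA j:{..<2 * n}. {..<j})"
  define v where "v = (\<lambda>(i, j). skew_unit (e i) (e j))"
  have fin: "finite I" unfolding I_def by (intro finite_imageI finite_SigmaI) auto
  have inj: "e i = e j \<longleftrightarrow> i = j" if "i < 2 * n" "j < 2 * n" for i j
    using bij that by (auto simp: bij_betw_def inj_on_def)
  have dual: "(\<lambda>(i, j) X. X $ e i $ e j) x (v y) = (if x = y then 1 else 0)" if "x \<in> I" "y \<in> I" for x y
    using that by (auto simp: I_def v_def skew_unit_def inj)
  have "mat_space.independent (v ` I)" "card (v ` I) = card I"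
    using mat_space.independent_dual_family[OF fin dual] by (auto split: prod.splits)
  moreover have "v ` I \<subseteq> skew_forms"
    by (auto simp: v_def skew_unit_in_skew_forms)
  moreover have "card I = (\<Sum>j<2 * n. j)"
    unfolding I_def by (subst card_image) (auto intro!: sum.cong)
  moreover have "(\<Sum>j<2 * n. j) = n * (2 * n - 1)"
    by (induction n) (auto simp: algebra_simps)
  ultimately show thesis using that by metis
qed

lemma skew_forms_subset_span:
  assumes "\<And>i j. i < j \<Longrightarrow> j < 2 * n \<Longrightarrow> skew_unit (e i) (e j) \<in> mat_space.span T"
  shows "skew_forms \<subseteq> mat_space.span T"
proof
  have 1: "skew_unit p q \<in> mat_space.span T" if "idx p < idx q" for p q
    using assms[OF that] by simp
  have "skew_unit p q \<in> mat_space.span T" for p q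
  proof (cases "idx p" "idx q" rule: linorder_cases)
    case equal
    then have "p = q" by (metis e_idx)
    then show ?thesis by (simp add: skew_unit_def mat_space.span_zero)
  next
    case greater
    have "skew_unit p q = - skew_unit q p" by (simp add: skew_unit_def)
    then show ?thesis using 1[OF greater] by (simp add: mat_space.span_neg)
  qed (use 1 in auto)
  then show "Q \<in> mat_space.span T" if "Q \<in> skew_forms" for Q :: "complex^'n^'n"
    by (subst skew_unit_expansion[OF that]) (intro mat_space.span_sum mat_space.span_scale)
qed

text \<open>On a pair, x E_p + y E_q = (x + y) E_p - y (E_p - E_q) for the diagonal units. So, up to
  differences within pairs, the diagonal is carried by the first members, with the pair sums as
  entries, and these add up to the trace.\<close>

lemma sl_subset_span:
  assumes off: "\<And>p q. p \<noteq> q \<Longrightarrow> matrix_unit p q \<in> mat_space.span T"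
    and diff: "\<And>i. i < n \<Longrightarrow> matrix_unit (e i) (e i) - matrix_unit (partner (e i)) (partner (e i)) \<in> mat_space.span T"
    and diag: "\<And>t. (\<Sum>i<n. t i) = 0 \<Longrightarrow> (\<Sum>i<n. mat_scale (t i) (matrix_unit (e i) (e i))) \<in> mat_space.span T"
  shows "sl \<subseteq> mat_space.span T"
proof
  fix X :: "complex^'n^'n" assume X: "X \<in> sl"
  let ?E = "\<lambda>p. matrix_unit p p"
  let ?t = "\<lambda>i. X $ e i $ e i + X $ partner (e i) $ partner (e i)"
  have "(\<Sum>p\<in>UNIV. mat_scale (X $ p $ p) (?E p)) =
      (\<Sum>i<n. mat_scale (?t i) (?E (e i)))
      - (\<Sum>i<n. mat_scale (X $ partner (e i) $ partner (e i)) (?E (e i) - ?E (partner (e i))))"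
    unfolding sum_UNIV_paired sum_subtractf[symmetric]
    by (intro sum.cong) (auto simp: mat_space.scale_left_distrib mat_space.scale_right_diff_distrib)
  also have "\<dots> \<in> mat_space.span T"
    using X[unfolded sl_iff sum_UNIV_paired]
    by (intro mat_space.span_diff diag mat_space.span_sum mat_space.span_scale diff) auto
  finally have D: "(\<Sum>p\<in>UNIV. mat_scale (X $ p $ p) (?E p)) \<in> mat_space.span T" .
  have "X = (\<Sum>p\<in>UNIV. \<Sum>q\<in>UNIV. mat_scale (X $ p $ q) (matrix_unit p q))"
    by (rule matrix_unit_expansion)
  also have "\<dots> = (\<Sum>p\<in>UNIV. mat_scale (X $ p $ p) (?E p) + (\<Sum>q\<in>UNIV - {p}. mat_scale (X $ p $ q) (matrix_unit p q)))"
    by (rule sum.cong[OF refl], rule sum.remove) auto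
  also have "\<dots> = (\<Sum>p\<in>UNIV. mat_scale (X $ p $ p) (?E p)) + (\<Sum>p\<in>UNIV. \<Sum>q\<in>UNIV - {p}. mat_scale (X $ p $ q) (matrix_unit p q))"
    by (rule sum.distrib)
  also have "\<dots> \<in> mat_space.span T"
    by (intro mat_space.span_add D mat_space.span_sum mat_space.span_scale off) auto
  finally show "X \<in> mat_space.span T" .
qed

section \<open>Kronecker form of the standard pair\<close>

text \<open>The lists \<open>us\<close> and \<open>vs\<close> are assembled block by block, so both
  matrices can be read off. That they are bases follows from spanning and from comparing their
  lengths with the sizes of known independent sets.\<close>

theorem std_form_Kronecker:
  assumes n: "n \<ge> 1" and \<kappa>: "inj_on \<kappa> {..<n}"
  shows "has_Kronecker_form mat_scale mat_scale sl skew_forms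
    (\<lambda>X. congruence_rep X (std_form \<kappa>)) (\<lambda>X. congruence_rep X (std_form (\<lambda>_. 1)))
    (replicate (3 * n) (Horizontal 1) @ replicate (2 * n * (n - 1)) (Horizontal 2) @ [Vertical n])"
proof -
  obtain c where c0: "\<And>i. i < n \<Longrightarrow> c i \<noteq> 0"
    and c_sum: "\<And>j. j + 1 < n \<Longrightarrow> (\<Sum>i<n. c i * \<kappa> i ^ j) = 0"
    and c_ex: "\<And>t. \<exists>g. (\<forall>i<n. t i = (\<Sum>j<n. g j * (c i * \<kappa> i ^ j))) \<and> g (n - 1) = (\<Sum>i<n. t i)"
    by (rule interpolation_weights[OF \<kappa>]) blast
  define k where "k p = \<kappa> (idx p mod n)" for p
  define A where "A X = congruence_rep X (std_form \<kappa>)" for X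
  define B where "B X = congruence_rep X (std_form (\<lambda>_. 1))" for X
  have A_add: "A (X + Y) = A X + A Y" and A_scale: "A (mat_scale d X) = mat_scale d (A X)"
    and A_sum: "A (sum f I) = (\<Sum>i\<in>I. A (f i))" and A_diff: "A (X - Y) = A X - A Y" and A_neg: "A (- X) = - A X"
    and B_add: "B (X + Y) = B X + B Y" and B_scale: "B (mat_scale d X) = mat_scale d (B X)"
    and B_sum: "B (sum f I) = (\<Sum>i\<in>I. B (f i))" and B_diff: "B (X - Y) = B X - B Y" and B_neg: "B (- X) = - B X"
    for X Y d I and f :: "nat \<Rightarrow> complex^'n^'n"
    by (simp_all add: A_def B_def L.add L.scale L.sum L.neg L.diff)
  have A_gl: "A (gl_unit p r) = mat_scale (k r) (skew_unit p r)"
    and B_gl: "B (gl_unit p r) = skew_unit p r" for p r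
    by (simp_all add: A_def B_def k_def congruence_gl_unit)
  have k_partner: "k (partner p) = k p" for p by (simp add: k_def)
  have k_e: "k (e i) = \<kappa> i" if "i < n" for i using that by (simp add: k_def)
  have k_neq: "k p \<noteq> k r" if "p \<noteq> r" "p \<noteq> partner r" for p r
  proof -
    have "idx p mod n \<noteq> idx r mod n" using that by (simp add: mod_idx_eq_iff)
    moreover have "idx p mod n < n" "idx r mod n < n" using n by auto
    ultimately show ?thesis using \<kappa> by (auto simp: k_def inj_on_def)
  qed
  have skew_swap: "skew_unit r p = - skew_unit p r" for p r by (simp add: skew_unit_def)

  \<comment> \<open>In the plane of \<open>gl_unit p r\<close> and \<open>gl_unit r p\<close>, the
    vector \<open>u0\<close> is killed by \<open>A\<close> and \<open>u1\<close> by
    \<open>B\<close>, and the signs give \<open>B (u0 p r) = A (u1 p r) = v p r\<close>: a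
    horizontal block of width 2.\<close>
  define u0 where "u0 p r = - (mat_scale (k p) (gl_unit p r) + mat_scale (k r) (gl_unit r p))" for p r
  define u1 where "u1 p r = gl_unit p r + gl_unit r p" for p r
  define v where "v p r = mat_scale (k r - k p) (skew_unit p r)" for p r
  have u0: "A (u0 p r) = 0" "B (u0 p r) = v p r" and u1: "A (u1 p r) = v p r" "B (u1 p r) = 0" for p r
    by (auto simp: u0_def u1_def v_def A_neg B_neg A_add B_add A_diff B_diff A_scale B_scale A_gl B_gl skew_swap[of r p]
        mat_space.scale_left_diff_distrib mult.commute)
  \<comment> \<open>On these diagonal units \<open>A\<close> is \<open>B\<close> followed by
    multiplication by \<kappa>_i, so \<open>A\<close> raises the exponent by one. The trace of
    \<open>u j\<close> vanishes for j < n - 1, which leaves n - 1 vectors \<open>u\<close> against n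
    vectors \<open>w\<close>.\<close>
  define u where "u j = (\<Sum>i<n. mat_scale (c i * \<kappa> i ^ j) (matrix_unit (e i) (e i)))" for j
  define w where "w j = (\<Sum>i<n. mat_scale (c i * \<kappa> i ^ j) (skew_unit (e i) (partner (e i))))" for j
  have u: "A (u j) = w (j + 1)" "B (u j) = w j" for j
    by (auto simp: u_def w_def A_sum B_sum A_scale B_scale matrix_unit_diag A_gl B_gl k_partner k_e algebra_simps
        intro!: sum.cong)
  \<comment> \<open>The 3n common kernel vectors: 2n units with \<open>skew_unit p p = 0\<close>,
    and n vectors \<open>u1\<close> inside a pair, where both scalars agree. They span the traceless
    parts of the diagonal 2 x 2 blocks.\<close>
  define z where "z = map (\<lambda>i. gl_unit (e i) (e i)) [0..<2 * n] @ map (\<lambda>i. u1 (e i) (partner (e i))) [0..<n]"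
  have z: "A x = 0" "B x = 0" if "x \<in> set z" for x
    using that by (auto simp: z_def A_gl B_gl u1 v_def k_partner skew_unit_def)
  obtain prs where prs: "set prs = unpaired" "distinct prs"
    using finite_distinct_list[OF card_unpaired(1)] by blast
  have len_prs: "length prs = 2 * n * (n - 1)"
    using distinct_card[OF prs(2)] prs(1) card_unpaired by simp

  \<comment> \<open>Each entry holds a block with its source and target basis vectors, in the order
    of the claimed block list.\<close>
  define ts :: "(block \<times> (complex^'n^'n) list \<times> (complex^'n^'n) list) list" where
    "ts = map (\<lambda>x. (Horizontal 1, [x], [])) z
      @ map (\<lambda>(i, j). (Horizontal 2, [u0 (e i) (e j), u1 (e i) (e j)], [v (e i) (e j)])) prs
      @ [(Vertical n, map u [0..<n - 1], map w [0..<n])]"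
  define us where "us = concat (map (\<lambda>(b, us, vs). us) ts)"
  define vs where "vs = concat (map (\<lambda>(b, us, vs). vs) ts)"
  have bs: "map fst ts = replicate (3 * n) (Horizontal 1) @ replicate (2 * n * (n - 1)) (Horizontal 2) @ [Vertical n]"
    by (simp add: ts_def z_def o_def case_prod_unfold map_replicate_const len_prs)
      (simp flip: replicate_add add: len_prs)
  note vs_mat = mat_space.vector_space_axioms
  have "matrix_represents mat_scale us vs (diag_block_mat (map (\<lambda>t. block_A (fst t)) ts)) A"
    unfolding us_def vs_def
  proof (rule matrix_represents_concat[OF vs_mat])
    fix t assume "t \<in> set ts"
    then show "matrix_represents mat_scale (case t of (b, us, vs) \<Rightarrow> us) (case t of (b, us, vs) \<Rightarrow> vs) (block_A (fst t)) A"
      unfolding ts_def using z u0 u1 u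
      by (auto intro!: matrix_represents_Horizontal_1 matrix_represents_Horizontal_2[OF vs_mat]
          matrix_represents_Vertical[OF vs_mat] simp del: One_nat_def)
  qed
  then have rep_A: "matrix_represents mat_scale us vs (diag_block_mat (map block_A (map fst ts))) A"
    by (simp add: o_def)
  have "matrix_represents mat_scale us vs (diag_block_mat (map (\<lambda>t. block_B (fst t)) ts)) B"
    unfolding us_def vs_def
  proof (rule matrix_represents_concat[OF vs_mat])
    fix t assume "t \<in> set ts"
    then show "matrix_represents mat_scale (case t of (b, us, vs) \<Rightarrow> us) (case t of (b, us, vs) \<Rightarrow> vs) (block_B (fst t)) B"
      unfolding ts_def using z u0 u1 u
      by (auto intro!: matrix_represents_Horizontal_1 matrix_represents_Horizontal_2[OF vs_mat]
          matrix_represents_Vertical[OF vs_mat] simp del: One_nat_def)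
  qed
  then have rep_B: "matrix_represents mat_scale us vs (diag_block_mat (map block_B (map fst ts))) B"
    by (simp add: o_def)

  have set_us: "set us = set z \<union> (\<Union>(i, j)\<in>unpaired. {u0 (e i) (e j), u1 (e i) (e j)}) \<union> u ` {..<n - 1}"
    by (auto simp: us_def ts_def prs(1)[symmetric] split: prod.splits)
  have set_vs: "set vs = (\<Union>(i, j)\<in>unpaired. {v (e i) (e j)}) \<union> w ` {..<n}"
    by (auto simp: vs_def ts_def prs(1)[symmetric] split: prod.splits)
  have "length us = length z + 2 * length prs + (n - 1)"
    by (simp add: us_def ts_def length_concat o_def case_prod_unfold sum_list_triv)
  also have "\<dots> = 3 * n + 4 * n * (n - 1) + (n - 1)" by (simp add: z_def len_prs)
  also have "\<dots> = CARD('n)\<^sup>2 - 1"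
    using n by (cases n) (auto simp: card_UNIV_eq power2_eq_square algebra_simps)
  finally have len_us: "length us = CARD('n)\<^sup>2 - 1" .
  have "length vs = length prs + n"
    by (simp add: vs_def ts_def length_concat o_def case_prod_unfold sum_list_triv)
  also have "\<dots> = n * (2 * n - 1)" using n by (cases n) (auto simp: len_prs)
  finally have len_vs: "length vs = n * (2 * n - 1)" .

  have trace_gl: "gl_unit p r \<in> sl" if "p \<noteq> partner r" for p r
    using that by (simp add: gl_unit_def sl_iff trace_matrix_unit flip: sum_distrib_left)
  note sl_closed = mat_space.subspace_add[OF subspace_sl] mat_space.subspace_scale[OF subspace_sl]
      mat_space.subspace_neg[OF subspace_sl] trace_gl
  have unpaired_neq: "e i \<noteq> e j" "e i \<noteq> partner (e j)" "e j \<noteq> partner (e i)" if "(i, j) \<in> unpaired" for i j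
    using that idx_partner[of "e i"] idx_partner[of "e j"]
    by (auto simp: unpaired_def dest!: arg_cong[of _ _ idx] split: if_splits)
  have u1_partner: "u1 (e i) (partner (e i)) = matrix_unit (e i) (e i) - matrix_unit (partner (e i)) (partner (e i))"
    if "i < n" for i
    using that by (simp add: u1_def gl_unit_def sgn_of_def[of "e i"] mat_space.scale_minus_left)
  have us_in: "set us \<subseteq> sl"
  proof -
    have "x \<in> sl" if "x \<in> set z" for x
      using that by (auto simp: z_def u1_partner trace_gl) (simp add: sl_iff trace_matrix_unit sum_subtractf)
    moreover have "u0 (e i) (e j) \<in> sl" "u1 (e i) (e j) \<in> sl" if "(i, j) \<in> unpaired" for i j
      unfolding u0_def u1_def by (intro sl_closed unpaired_neq(2,3)[OF that])+
    moreover have "u j \<in> sl" if "j < n - 1" for j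
    proof -
      have "(\<Sum>p\<in>UNIV. u j $ p $ p) = (\<Sum>i<n. c i * \<kappa> i ^ j * (\<Sum>p\<in>UNIV. matrix_unit (e i) (e i) $ p $ p))"
        unfolding u_def sum_nth2 mat_scale_nth sum_distrib_left by (rule sum.swap)
      then show ?thesis using c_sum[of j] that by (simp add: sl_iff trace_matrix_unit)
    qed
    ultimately show ?thesis unfolding set_us by auto
  qed
  have vs_in: "set vs \<subseteq> skew_forms"
    unfolding set_vs v_def w_def
    by (auto intro!: mat_space.subspace_sum[OF subspace_skew_forms] mat_space.subspace_scale[OF subspace_skew_forms]
        skew_unit_in_skew_forms)

  let ?T = "mat_space.span (set us)"
  have z_in: "x \<in> ?T" if "x \<in> set z" for x using that set_us by (auto intro: mat_space.span_base)
  have gl_unpaired: "gl_unit (e i) (e j) \<in> ?T \<and> gl_unit (e j) (e i) \<in> ?T" if "(i, j) \<in> unpaired" for i j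
  proof -
    let ?p = "e i" and ?r = "e j"
    have 1: "u0 ?p ?r \<in> ?T" "u1 ?p ?r \<in> ?T"
      using that set_us by (auto intro!: mat_space.span_base)
    have k: "k ?p \<noteq> k ?r" using k_neq unpaired_neq[OF that] by blast
    \<comment> \<open>The combination u0 + k_r u1 equals (k_r - k_p) times
      \<open>gl_unit ?p ?r\<close>; distinct scalars allow the division.\<close>
    have "mat_scale (1 / (k ?r - k ?p)) (u0 ?p ?r + mat_scale (k ?r) (u1 ?p ?r)) = 
        mat_scale (1 / (k ?r - k ?p)) (mat_scale (k ?r - k ?p) (gl_unit ?p ?r))"
      by (simp add: u0_def u1_def mat_space.scale_right_distrib mat_space.scale_left_diff_distrib)
    then have "gl_unit ?p ?r = mat_scale (1 / (k ?r - k ?p)) (u0 ?p ?r + mat_scale (k ?r) (u1 ?p ?r))"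
      using k by simp
    then have 2: "gl_unit ?p ?r \<in> ?T"
      using 1 by (metis mat_space.span_add mat_space.span_scale)
    have "gl_unit ?r ?p = u1 ?p ?r - gl_unit ?p ?r" by (simp add: u1_def)
    then show ?thesis using 1 2 by (metis mat_space.span_diff)
  qed
  have gl_in: "gl_unit p r \<in> ?T" if "p \<noteq> partner r" for p r
  proof (cases "p = r")
    case True
    have "gl_unit (e (idx p)) (e (idx p)) \<in> set z" unfolding z_def using idx_less[of p] by (auto simp del: e_idx idx_less)
    then show ?thesis using z_in True by simp
  next
    case False
    have "idx p \<noteq> idx r" using False by (metis e_idx)
    moreover have "idx p \<noteq> idx r + n" "idx r \<noteq> idx p + n"
      using that idx_less[of p] idx_less[of r] by (auto simp: partner_def simp del: idx_less)
        (metis e_idx)+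
    ultimately have "(idx p, idx r) \<in> unpaired \<or> (idx r, idx p) \<in> unpaired"
      by (auto simp: unpaired_def)
    then show ?thesis using gl_unpaired by fastforce
  qed
  have "sl \<subseteq> ?T"
  proof (rule sl_subset_span)
    show "matrix_unit p q \<in> ?T" if "p \<noteq> q" for p q
      unfolding matrix_unit_eq_gl_unit[of p q] using that by (intro mat_space.span_scale gl_in) simp
    show "matrix_unit (e i) (e i) - matrix_unit (partner (e i)) (partner (e i)) \<in> ?T" if "i < n" for i
      using that by (subst u1_partner[symmetric]) (auto intro: z_in simp: z_def)
    show "(\<Sum>i<n. mat_scale (t i) (matrix_unit (e i) (e i))) \<in> ?T" if t: "(\<Sum>i<n. t i) = 0" for t
    proof -
      \<comment> \<open>The coefficient at n - 1 is the trace, hence 0, so the vector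
        \<open>u (n - 1)\<close>, absent from \<open>us\<close>, does not occur.\<close>
      obtain g where g: "\<And>i. i < n \<Longrightarrow> t i = (\<Sum>j<n. g j * (c i * \<kappa> i ^ j))" "g (n - 1) = 0"
        using c_ex[of t] t by auto
      have "(\<Sum>i<n. mat_scale (t i) (matrix_unit (e i) (e i))) =
          (\<Sum>i<n. \<Sum>j<n. mat_scale (g j) (mat_scale (c i * \<kappa> i ^ j) (matrix_unit (e i) (e i))))"
        by (intro sum.cong refl) (simp add: g(1) mat_space.scale_sum_left)
      also have "\<dots> = (\<Sum>j<n. \<Sum>i<n. mat_scale (g j) (mat_scale (c i * \<kappa> i ^ j) (matrix_unit (e i) (e i))))"
        by (rule sum.swap)
      also have "\<dots> = (\<Sum>j<n. mat_scale (g j) (u j))" by (simp only: u_def mat_space.scale_sum_right)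
      also have "\<dots> \<in> ?T"
      proof (intro mat_space.span_sum)
        fix j assume j: "j \<in> {..<n}"
        show "mat_scale (g j) (u j) \<in> ?T"
        proof (cases "j = n - 1")
          case True
          then show ?thesis using g(2) by (simp add: mat_space.span_zero)
        next
          case False
          then have "u j \<in> set us" unfolding set_us using j by auto
          then show ?thesis by (intro mat_space.span_scale mat_space.span_base)
        qed
      qed
      finally show ?thesis .
    qed
  qed
  then have span_us: "?T = sl"
    using mat_space.span_minimal[OF us_in subspace_sl] by blast

  let ?S = "mat_space.span (set vs)"
  have "skew_forms \<subseteq> ?S"
  proof (rule skew_forms_subset_span)
    fix i j assume ij: "i < j" "j < 2 * n"
    show "skew_unit (e i) (e j) \<in> ?S"
    proof (cases "j = i + n")
      case True
      then have i: "i < n" using ij by simp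
      \<comment> \<open>The indicator of i is expanded in the vectors c, \<kappa> c, \<kappa>^2 c
        and so on. All n powers are available here, because \<open>vs\<close> contains
        \<open>w (n - 1)\<close>.\<close>
      obtain g where g: "\<And>l. l < n \<Longrightarrow> (if l = i then 1 else 0) = (\<Sum>j<n. g j * (c l * \<kappa> l ^ j))"
        using c_ex[of "\<lambda>l. if l = i then 1 else 0"] by auto
      have "skew_unit (e i) (e j) = (\<Sum>l<n. if l = i then skew_unit (e l) (partner (e l)) else 0)"
        using i True by (simp add: partner_e)
      also have "\<dots> = (\<Sum>l<n. mat_scale (if l = i then 1 else 0) (skew_unit (e l) (partner (e l))))"
        by (intro sum.cong) auto
      also have "\<dots> = (\<Sum>l<n. \<Sum>j<n. mat_scale (g j) (mat_scale (c l * \<kappa> l ^ j) (skew_unit (e l) (partner (e l)))))"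
        by (intro sum.cong refl) (simp add: g mat_space.scale_sum_left)
      also have "\<dots> = (\<Sum>j<n. \<Sum>l<n. mat_scale (g j) (mat_scale (c l * \<kappa> l ^ j) (skew_unit (e l) (partner (e l)))))"
        by (rule sum.swap)
      also have "\<dots> = (\<Sum>j<n. mat_scale (g j) (w j))" by (simp only: w_def mat_space.scale_sum_right)
      also have "\<dots> \<in> ?S"
        by (intro mat_space.span_sum mat_space.span_scale mat_space.span_base) (auto simp: set_vs)
      finally show ?thesis .
    next
      case False
      then have un: "(i, j) \<in> unpaired" using ij by (simp add: unpaired_def)
      then have k: "k (e i) \<noteq> k (e j)" using k_neq unpaired_neq[OF un] by blast
      have "v (e i) (e j) \<in> ?S" using un by (auto simp: set_vs intro!: mat_space.span_base)
      then have "mat_scale (1 / (k (e j) - k (e i))) (v (e i) (e j)) \<in> ?S" by (rule mat_space.span_scale)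
      then show ?thesis using k by (simp add: v_def)
    qed
  qed
  then have span_vs: "?S = skew_forms"
    using mat_space.span_minimal[OF vs_in subspace_skew_forms] by blast

  have "ordered_basis mat_scale sl us"
  proof -
    obtain C where "mat_space.independent C" "C \<subseteq> (sl :: (complex^'n^'n) set)" "card C = CARD('n)\<^sup>2 - 1"
      by (rule sl_independent_set)
    then show ?thesis
      using mat_space.independent_if_span_large[of C us] span_us len_us by (auto simp: ordered_basis_def)
  qed
  moreover have "ordered_basis mat_scale skew_forms vs"
  proof -
    obtain C where "mat_space.independent C" "C \<subseteq> (skew_forms :: (complex^'n^'n) set)" "card C = n * (2 * n - 1)"
      by (rule skew_independent_set)
    then show ?thesis
      using mat_space.independent_if_span_large[of C vs] span_vs len_vs by (auto simp: ordered_basis_def)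
  qed
  moreover have "\<forall>b \<in> set (map fst ts). proper_block b" unfolding bs using n by auto
  ultimately show ?thesis
    using rep_A rep_B unfolding has_Kronecker_form_def bs A_def B_def by blast
qed

end

section \<open>Normal form of a pair of skew-symmetric matrices\<close>

text \<open>The submatrix of \<open>S\<close> without row and column \<open>i\<close> is skew-symmetric of odd size, hence singular. To stay
  in the same type, \<open>T\<close> keeps the index \<open>i\<close> and has \<open>1\<close> at \<open>(i, i)\<close>.\<close>

lemma skew_kernel_second_vector:
  fixes S :: "complex^'n^'n"
  assumes S: "S \<in> skew_forms" and even: "even (CARD('n))" and x: "S *v x = 0" "x $ i \<noteq> 0"
  obtains y where "y \<noteq> 0" "y $ i = 0" "S *v y = 0"
proof -
  have skew: "S $ p $ q = - (S $ q $ p)" for p q using S unfolding skew_forms_iff by blast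
  define T :: "complex^'n^'n" where
    "T = (\<chi> p q. if p = i then (if q = i then 1 else 0) else if q = i then 0 else S $ p $ q)"
  \<comment> \<open>Transposing \<open>T\<close> negates all rows but row i, which is multiplication
    by \<open>D\<close>. An odd number of signs gives det D = -1, so det T = - det T.\<close>
  define D :: "complex^'n^'n" where "D = (\<chi> p q. if p = q then (if p = i then 1 else - 1) else 0)"
  have "Finite_Cartesian_Product.transpose T $ p $ q = (D ** T) $ p $ q" for p q
  proof -
    have "(D ** T) $ p $ q = (\<Sum>k\<in>UNIV. if k = p then (if p = i then 1 else - 1) * T $ p $ q else 0)"
      unfolding matrix_matrix_mult_def vec_lambda_beta by (intro sum.cong) (auto simp: D_def)
    also have "\<dots> = (if p = i then 1 else - 1) * T $ p $ q" by simp
    finally show ?thesis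
      using skew[of p q] by (auto simp: T_def Finite_Cartesian_Product.transpose_def)
  qed
  then have "Finite_Cartesian_Product.transpose T = D ** T" by (intro mat_eqI)
  then have "Determinants.det T = Determinants.det D * Determinants.det T"
    by (metis Determinants.det_transpose Determinants.det_mul)
  moreover have "Determinants.det D = (\<Prod>k\<in>UNIV. D $ k $ k)"
    by (intro Determinants.det_diagonal) (simp add: D_def)
  moreover have "(\<Prod>k\<in>UNIV. D $ k $ k) = - 1"
  proof -
    have "(\<Prod>k\<in>UNIV. D $ k $ k) = D $ i $ i * (\<Prod>k\<in>UNIV - {i}. D $ k $ k)" by (rule prod.remove) auto
    also have "(\<Prod>k\<in>UNIV - {i}. D $ k $ k) = (\<Prod>k\<in>UNIV - {i}. - 1)" by (intro prod.cong) (auto simp: D_def)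
    also have "\<dots> = (- 1) ^ (CARD('n) - 1)" by (simp add: card_Diff_subset)
    also have "odd (CARD('n) - 1)" using even zero_less_card_finite[where 'a = 'n] by (simp del: zero_less_card_finite)
    then have "(- 1 :: complex) ^ (CARD('n) - 1) = - 1" by simp
    finally show ?thesis by (simp add: D_def)
  qed
  ultimately have "Determinants.det T = 0" by simp
  then obtain y where y: "T *v y = 0" "y \<noteq> 0"
    by (metis invertible_det_nz invertible_left_inverse matrix_left_invertible_ker)
  \<comment> \<open>Row i of \<open>T\<close> is a unit vector, so the equation T y = 0 contains y_i
    = 0.\<close>
  have "(\<Sum>k\<in>UNIV. T $ i $ k * y $ k) = (\<Sum>k\<in>UNIV. if k = i then y $ k else 0)"
    by (intro sum.cong) (auto simp: T_def)
  then have yi: "y $ i = 0"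
    using arg_cong[OF y(1), of "\<lambda>v. v $ i"] by (simp add: matrix_vector_mult_def)
  have Sy: "(S *v y) $ k = 0" if "k \<noteq> i" for k
  proof -
    have "(S *v y) $ k = (T *v y) $ k"
      unfolding matrix_vector_mult_def vec_lambda_beta
      using that yi by (intro sum.cong) (auto simp: T_def)
    then show ?thesis using y by simp
  qed
  \<comment> \<open>By skew symmetry x^T S y = - (S x)^T y = 0. Since S y already vanishes off i,
    only x_i (S y)_i remains, and x_i is not 0.\<close>
  have "(\<Sum>k\<in>UNIV. x $ k * (S *v y) $ k) = (\<Sum>k\<in>UNIV. \<Sum>q\<in>UNIV. x $ k * S $ k $ q * y $ q)"
    by (simp add: matrix_vector_mult_def sum_distrib_left mult.assoc)
  also have "\<dots> = (\<Sum>q\<in>UNIV. \<Sum>k\<in>UNIV. x $ k * S $ k $ q * y $ q)" by (rule sum.swap)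
  also have "\<dots> = (\<Sum>q\<in>UNIV. - ((S *v x) $ q) * y $ q)"
  proof (intro sum.cong refl)
    fix q
    have "(\<Sum>k\<in>UNIV. x $ k * S $ k $ q * y $ q) = (\<Sum>k\<in>UNIV. - (S $ q $ k * x $ k) * y $ q)"
      by (intro sum.cong refl) (subst skew, simp)
    then show "(\<Sum>k\<in>UNIV. x $ k * S $ k $ q * y $ q) = - ((S *v x) $ q) * y $ q"
      by (simp add: matrix_vector_mult_def sum_negf sum_distrib_right)
  qed
  also have "\<dots> = 0" using x(1) by simp
  finally have "0 = (\<Sum>k\<in>UNIV. x $ k * (S *v y) $ k)" by simp
  also have "\<dots> = (\<Sum>k\<in>UNIV. if k = i then x $ k * (S *v y) $ k else 0)"
    by (intro sum.cong) (auto simp: Sy)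
  finally have "(S *v y) $ i = 0" using x(2) by simp
  then have "S *v y = 0" using Sy by (metis Finite_Cartesian_Product.vec_eq_iff zero_index)
  then show thesis using that y yi by blast
qed

text \<open>Applying a - \<kappa>_j b to the relation removes the j-th term and multiplies the
  others by \<kappa>_i - \<kappa>_j; injectivity of b then strips b off. The \<open>z i\<close> may
  be arbitrary elements of the eigenspaces, zero included, so eigenspaces of dimension 2 are
  covered.\<close>

lemma pencil_eigenvectors_independent:
  fixes a b :: "complex^'n^'n"
  assumes "finite I" "inj_on \<kappa> I" and b: "\<And>x. b *v x = 0 \<Longrightarrow> x = 0"
    and "\<And>i. i \<in> I \<Longrightarrow> a *v z i = \<kappa> i *s (b *v z i)" "(\<Sum>i\<in>I. z i) = 0" "i \<in> I"
  shows "z i = 0"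
  using assms(1,2,4,5,6)
proof (induction I arbitrary: z i)
  case (insert j F)
  note neq = insert.hyps
  have sum: "M *v (\<Sum>i\<in>A. f i) = (\<Sum>i\<in>A. M *v f i)" for M :: "complex^'n^'n" and A and f :: "_ \<Rightarrow> complex^'n"
    by (rule vec.linear_sum) (rule matrix_vector_mul_linear_gen)
  define y where "y i = (\<kappa> i - \<kappa> j) *s z i" for i
  have "b *v (\<Sum>i\<in>F. y i) = (\<Sum>i\<in>F. a *v z i - \<kappa> j *s (b *v z i))"
    unfolding sum y_def using insert.prems(2)
    by (intro sum.cong) (simp_all add: vector_scalar_commute vec.scale_left_diff_distrib matrix_vector_mult_diff_distrib)
  also have "\<dots> = (\<Sum>i\<in>insert j F. a *v z i - \<kappa> j *s (b *v z i))"
    using insert.hyps insert.prems(2)[of j] by simp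
  also have "\<dots> = a *v (\<Sum>i\<in>insert j F. z i) - \<kappa> j *s (b *v (\<Sum>i\<in>insert j F. z i))"
    by (simp only: sum sum_subtractf vec.scale_sum_right)
  also have "\<dots> = 0" using insert.prems(3) by simp
  finally have y0: "(\<Sum>i\<in>F. y i) = 0" by (rule b)
  have "y i = 0" if "i \<in> F" for i
  proof (rule insert.IH[OF _ _ y0 that])
    show "inj_on \<kappa> F" using insert.prems(1) by simp
    show "a *v y i = \<kappa> i *s (b *v y i)" if "i \<in> F" for i
      unfolding y_def vector_scalar_commute using insert.prems(2)[of i] that
      by (metis insertI2 vec.scale_left_commute)
  qed
  moreover have "\<kappa> i \<noteq> \<kappa> j" if "i \<in> F" for i
    using that insert.prems(1) insert.hyps by (auto simp: inj_on_def)
  ultimately have "z i = 0" if "i \<in> F" for i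
    using that by (simp add: y_def)
  moreover from this have "z j = 0" using insert.prems(3) insert.hyps by simp
  ultimately show ?case using insert.prems(4) by blast
qed simp

text \<open>The bilinear form x^T M y, without conjugation.\<close>

definition form_value :: "complex^'n^'n \<Rightarrow> complex^'n \<Rightarrow> complex^'n \<Rightarrow> complex" where
  "form_value M x y = (\<Sum>p\<in>UNIV. x $ p * (M *v y) $ p)"

lemma form_value_scale: "form_value M (c *s x) y = c * form_value M x y"
    "form_value M x (c *s y) = c * form_value M x y"
  unfolding form_value_def vector_scalar_commute sum_distrib_left
  by (intro sum.cong refl; simp)+

lemma form_value_swap:
  assumes "M \<in> skew_forms"
  shows "form_value M x y = - form_value M y x"
proof -
  have skew: "M $ p $ q = - (M $ q $ p)" for p q using assms unfolding skew_forms_iff by blast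
  have "form_value M x y = (\<Sum>p\<in>UNIV. \<Sum>q\<in>UNIV. x $ p * (M $ p $ q * y $ q))"
    by (simp add: form_value_def matrix_vector_mult_def sum_distrib_left)
  also have "\<dots> = (\<Sum>q\<in>UNIV. \<Sum>p\<in>UNIV. x $ p * (M $ p $ q * y $ q))" by (rule sum.swap)
  also have "\<dots> = (\<Sum>q\<in>UNIV. \<Sum>p\<in>UNIV. - (y $ q * (M $ q $ p * x $ p)))"
    by (intro sum.cong refl) (subst skew, simp)
  also have "\<dots> = - form_value M y x"
    by (simp add: form_value_def matrix_vector_mult_def sum_distrib_left sum_negf)
  finally show ?thesis .
qed

lemma matrix_vector_mult_axis: "M *v axis k 1 = column k (M :: complex^'n^'m)"
proof -
  have "(\<Sum>j\<in>UNIV. M $ i $ j * axis k 1 $ j) = (\<Sum>j\<in>UNIV. if j = k then M $ i $ j else 0)" for i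
    by (intro sum.cong) (auto simp: axis_def)
  then show ?thesis by (simp add: Finite_Cartesian_Product.vec_eq_iff matrix_vector_mult_def column_def)
qed

lemma matrix_congruence_nth:
  "(Finite_Cartesian_Product.transpose E ** M ** E) $ p $ q = form_value M (column p E) (column q E)"
proof -
  have "(Finite_Cartesian_Product.transpose E ** (M ** E)) $ p $ q = form_value M (column p E) (column q E)"
    by (simp add: form_value_def matrix_matrix_mult_def matrix_vector_mult_def column_def
        Finite_Cartesian_Product.transpose_def)
  then show ?thesis by (simp add: matrix_mul_assoc)
qed

context paired_enumeration
begin

text \<open>A relation between the columns groups into one vector per pair, lying in the eigenspace
  of that pair. Independence of the eigenspaces kills every group, and \<open>ind\<close> settles
  the two coefficients inside it.\<close>

lemma eigenvector_columns_injective: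
  fixes a b E :: "complex^'n^'n"
  assumes \<kappa>: "inj_on \<kappa> {..<n}" and b: "\<And>x. b *v x = 0 \<Longrightarrow> x = 0"
    and eig: "\<And>p. a *v column p E = \<kappa> (idx p mod n) *s (b *v column p E)"
    and ind: "\<And>i c d. i < n \<Longrightarrow> c *s column (e i) E + d *s column (partner (e i)) E = 0 \<Longrightarrow> c = 0 \<and> d = 0"
  shows "invertible E"
proof -
  have "c = 0" if c: "E *v c = 0" for c
  proof -
    define z where "z i = c $ e i *s column (e i) E + c $ partner (e i) *s column (partner (e i)) E" for i
    have "(\<Sum>i<n. z i) = 0" using c unfolding matrix_mult_sum sum_UNIV_paired z_def .
    moreover have "a *v z i = \<kappa> i *s (b *v z i)" if "i < n" for i
      using eig[of "e i"] eig[of "partner (e i)"] that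
      by (simp add: z_def matrix_vector_right_distrib vector_scalar_commute mult.commute vec.scale_right_distrib)
    ultimately have "z i = 0" if "i < n" for i
      using pencil_eigenvectors_independent[of "{..<n}" \<kappa> b a z i] \<kappa> b that by auto
    then have 0: "c $ e i = 0" "c $ partner (e i) = 0" if "i < n" for i
      using ind[OF that] that by (auto simp: z_def)
    have "c $ p = 0" for p
    proof (cases "idx p < n")
      case True
      then show ?thesis using 0(1)[of "idx p"] by simp
    next
      case False
      then have "idx (partner p) < n" using idx_less[of p] by (auto simp: idx_partner simp del: idx_less)
      then show ?thesis using 0(2)[of "idx (partner p)"] by simp
    qed
    then show "c = 0" by (simp add: Finite_Cartesian_Product.vec_eq_iff)
  qed
  then show ?thesis by (metis invertible_left_inverse matrix_left_invertible_ker)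
qed

text \<open>For eigenvectors u, v of different pairs, a(u, v) is both \<kappa>_i b(u, v) and
  \<kappa>_j b(u, v), so b(u, v) = 0. In a basis of eigenvectors both forms therefore split into 2 x
  2 skew blocks. Those of b are non-zero by nondegeneracy and are normalised by rescaling one vector
  of each pair.\<close>

theorem skew_pair_normal_form:
  fixes a b :: "complex^'n^'n"
  assumes a: "a \<in> skew_forms" and b: "b \<in> skew_forms" and inj: "\<And>x. b *v x = 0 \<Longrightarrow> x = 0"
    and \<kappa>: "inj_on \<kappa> {..<n}"
    and ev: "\<And>i. i < n \<Longrightarrow> \<exists>x. x \<noteq> 0 \<and> a *v x = \<kappa> i *s (b *v x)"
  obtains P P' where "P ** P' = Finite_Cartesian_Product.mat 1" "P' ** P = Finite_Cartesian_Product.mat 1"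
    "a = P ** std_form \<kappa> ** Finite_Cartesian_Product.transpose P"
    "b = P ** std_form (\<lambda>_. 1) ** Finite_Cartesian_Product.transpose P"
proof -
  \<comment> \<open>A coordinate j with x_j non-zero and y_j = 0 records that x and y are
    independent.\<close>
  have "\<exists>x y j. x $ j \<noteq> 0 \<and> y \<noteq> 0 \<and> y $ j = 0 \<and> a *v x = \<kappa> i *s (b *v x) \<and> a *v y = \<kappa> i *s (b *v y)"
    if i: "i < n" for i
  proof -
    obtain x where x: "x \<noteq> 0" "a *v x = \<kappa> i *s (b *v x)" using ev[OF i] by blast
    then obtain j where j: "x $ j \<noteq> 0" by (auto simp: Finite_Cartesian_Product.vec_eq_iff)
    let ?S = "a - mat_scale (\<kappa> i) b"
    have S: "?S *v y = a *v y - \<kappa> i *s (b *v y)" for y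
      by (simp add: Finite_Cartesian_Product.vec_eq_iff matrix_vector_mult_def left_diff_distrib
          sum_subtractf sum_distrib_left mult.assoc)
    have "?S \<in> skew_forms"
      by (intro mat_space.subspace_diff[OF subspace_skew_forms] a mat_space.subspace_scale[OF subspace_skew_forms] b)
    moreover have "even (CARD('n))" by (simp add: card_UNIV_eq)
    ultimately obtain y where "y \<noteq> 0" "y $ j = 0" "?S *v y = 0"
      by (rule skew_kernel_second_vector[of ?S x j]) (use x j in \<open>auto simp: S\<close>)
    then show ?thesis using x j by (intro exI[of _ x] exI[of _ y] exI[of _ j]) (auto simp: S)
  qed
  then obtain x y j where xy: "\<And>i. i < n \<Longrightarrow> x i $ j i \<noteq> 0" "\<And>i. i < n \<Longrightarrow> y i \<noteq> 0"
      "\<And>i. i < n \<Longrightarrow> y i $ j i = 0" "\<And>i. i < n \<Longrightarrow> a *v x i = \<kappa> i *s (b *v x i)"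
      "\<And>i. i < n \<Longrightarrow> a *v y i = \<kappa> i *s (b *v y i)"
    by metis
  \<comment> \<open>The index type is inhabited.\<close>
  have n0: "n > 0" using idx_less[of undefined] by linarith
  \<comment> \<open>The factor d rescales the second vector of each pair. It is first 1, to prove
    that the pairings \<open>\<beta> i\<close> are non-zero, and then 1 / \<beta>_i, to normalise
    them.\<close>
  define cols where "cols d p = (if idx p < n then x (idx p) else d (idx p - n) *s y (idx p - n))" for d p
  define E :: "(nat \<Rightarrow> complex) \<Rightarrow> complex^'n^'n" where "E d = (\<chi> q p. cols d p $ q)" for d
  have col: "column p (E d) = cols d p" for p d
    by (simp add: E_def column_def Finite_Cartesian_Product.vec_eq_iff)
  have cols_e: "cols d (e i) = x i" "cols d (partner (e i)) = d i *s y i" if "i < n" for d i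
    using that by (simp_all add: cols_def partner_e)
  have eig: "a *v cols d p = \<kappa> (idx p mod n) *s (b *v cols d p)" for d p
    using idx_less[of p] xy(4)[of "idx p"] xy(5)[of "idx p - n"]
    by (auto simp: cols_def idx_mod vector_scalar_commute mult.commute simp del: idx_less)
  have inv_E: "invertible (E d)" if d: "\<And>i. i < n \<Longrightarrow> d i \<noteq> 0" for d
  proof (rule eigenvector_columns_injective[OF \<kappa> inj])
    show "a *v column p (E d) = \<kappa> (idx p mod n) *s (b *v column p (E d))" for p
      unfolding col by (rule eig)
    show "s = 0 \<and> t = 0" if "i < n" "s *s column (e i) (E d) + t *s column (partner (e i)) (E d) = 0" for i s t
    proof -
      have eq: "s *s x i + (t * d i) *s y i = 0" using that by (simp add: col cols_e)
      then have "s = 0"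
        using xy(1,3)[OF that(1)] by (auto simp: Finite_Cartesian_Product.vec_eq_iff dest!: spec[of _ "j i"])
      then show ?thesis using eq xy(2)[OF that(1)] d[OF that(1)] by simp
    qed
  qed
  have form_a: "form_value a u v = c * form_value b u v" if "a *v v = c *s (b *v v)" for u v c
    using that by (simp add: form_value_def sum_distrib_left mult_ac)
  have orth: "form_value b (cols d p) (cols d q) = 0" if "q \<noteq> partner p" for d p q
  proof (cases "p = q")
    case True
    then show ?thesis using form_value_swap[OF b, of "cols d p" "cols d q"] by simp
  next
    case False
    let ?u = "cols d p" and ?v = "cols d q"
    have "\<kappa> (idx q mod n) * form_value b ?u ?v = form_value a ?u ?v" by (rule form_a[OF eig, symmetric])
    also have "\<dots> = - form_value a ?v ?u" by (rule form_value_swap[OF a])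
    also have "\<dots> = \<kappa> (idx p mod n) * form_value b ?u ?v"
      unfolding form_a[OF eig[of d p], of ?v] form_value_swap[OF b, of ?v] by simp
    finally have "(\<kappa> (idx q mod n) - \<kappa> (idx p mod n)) * form_value b ?u ?v = 0" by (simp add: left_diff_distrib)
    moreover have "idx q mod n \<noteq> idx p mod n" using False that by (auto simp: mod_idx_eq_iff)
    then have "\<kappa> (idx q mod n) \<noteq> \<kappa> (idx p mod n)" using \<kappa> n0 by (auto simp: inj_on_def)
    ultimately show ?thesis by simp
  qed
  define \<beta> where "\<beta> i = form_value b (x i) (y i)" for i
  have \<beta>: "\<beta> i \<noteq> 0" if i: "i < n" for i
  proof
    \<comment> \<open>Otherwise x_i would be orthogonal to every column of the invertible matrix
      \<open>E (\<lambda>_. 1)\<close>, hence in the radical of b.\<close>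
    assume "\<beta> i = 0"
    let ?E = "E (\<lambda>_. 1)"
    have "form_value b (x i) (column q ?E) = 0" for q
      using orth[of q "e i" "\<lambda>_. 1"] \<open>\<beta> i = 0\<close> i by (cases "q = partner (e i)") (auto simp: col cols_e \<beta>_def)
    then have "(Finite_Cartesian_Product.transpose ?E ** b ** ?E) $ q $ e i = 0" for q
      using i by (simp add: matrix_congruence_nth col cols_e) (subst form_value_swap[OF b], simp)
    then have "(Finite_Cartesian_Product.transpose ?E ** b ** ?E) *v axis (e i) 1 = 0"
      by (simp add: Finite_Cartesian_Product.vec_eq_iff matrix_vector_mult_axis column_def)
    then have "Finite_Cartesian_Product.transpose ?E *v (b *v (?E *v axis (e i) 1)) = 0"
      by (simp add: matrix_vector_mul_assoc matrix_mul_assoc)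
    moreover have "?E *v axis (e i) 1 = x i" using i by (simp add: matrix_vector_mult_axis col cols_e)
    moreover have "invertible (Finite_Cartesian_Product.transpose ?E)"
      using inv_E[of "\<lambda>_. 1"] by (simp add: invertible_det_nz Determinants.det_transpose)
    ultimately have "x i = 0"
      using inj by (metis invertible_left_inverse matrix_left_invertible_ker)
    then show False using xy(1)[OF i] by simp
  qed
  define d where "d i = 1 / \<beta> i" for i
  have inv: "invertible (E d)" by (rule inv_E) (simp add: d_def \<beta>)
  have one: "form_value b (cols d p) (cols d (partner p)) = sgn_of p" for p
  proof (cases "idx p < n")
    case True
    then show ?thesis using cols_e[of "idx p" d] \<beta>[of "idx p"]
      by (simp add: form_value_scale sgn_of_def d_def flip: \<beta>_def)
  next
    case False
    then have "idx (partner p) < n" using idx_less[of p] by (auto simp: idx_partner simp del: idx_less)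
    then show ?thesis using False cols_e[of "idx (partner p)" d] \<beta>[of "idx (partner p)"]
      by (subst form_value_swap[OF b]) (simp add: form_value_scale sgn_of_def d_def flip: \<beta>_def)
  qed
  have b_std: "Finite_Cartesian_Product.transpose (E d) ** b ** E d = std_form (\<lambda>_. 1)"
    by (rule mat_eqI) (simp add: matrix_congruence_nth col std_form_def orth one)
  have a_std: "Finite_Cartesian_Product.transpose (E d) ** a ** E d = std_form \<kappa>"
    by (rule mat_eqI) (simp add: matrix_congruence_nth col form_a[OF eig] std_form_def orth one)
  obtain F where F: "E d ** F = Finite_Cartesian_Product.mat 1" "F ** E d = Finite_Cartesian_Product.mat 1"
    using inv by (auto simp: invertible_def)
  have T: "Finite_Cartesian_Product.transpose F ** Finite_Cartesian_Product.transpose (E d) = Finite_Cartesian_Product.mat 1"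
    "Finite_Cartesian_Product.transpose (E d) ** Finite_Cartesian_Product.transpose F = Finite_Cartesian_Product.mat 1"
    using F by (simp_all add: transpose_mat flip: matrix_transpose_mul)
  \<comment> \<open>Inverting the congruence: the required P is the transpose of the inverse F of
    \<open>E d\<close>.\<close>
  have recover: "M = Finite_Cartesian_Product.transpose F ** (Finite_Cartesian_Product.transpose (E d) ** M ** E d)
      ** Finite_Cartesian_Product.transpose (Finite_Cartesian_Product.transpose F)" for M :: "complex^'n^'n"
  proof -
    have "Finite_Cartesian_Product.transpose F ** (Finite_Cartesian_Product.transpose (E d) ** M ** E d) ** F
      = (Finite_Cartesian_Product.transpose F ** Finite_Cartesian_Product.transpose (E d)) ** M ** (E d ** F)"
      by (simp only: matrix_mul_assoc)
    then show ?thesis by (simp add: T F)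
  qed
  show thesis
    using that[OF T] recover[of a] recover[of b] by (simp only: a_std b_std)
qed

end

section \<open>From the standard pair to general pairs\<close>

context paired_enumeration
begin

text \<open>Conjugation \<open>\<phi>\<close> by P on \<open>sl\<close> and congruence
  \<open>\<psi>\<close> by P on \<open>skew_forms\<close> are bijective and intertwine the action,
  so they carry the Kronecker form of the standard pair over to (a, b).\<close>

theorem skew_pair_Kronecker:
  fixes a b :: "complex^'n^'n"
  assumes n: "n \<ge> 1" and a: "a \<in> skew_forms" and b: "b \<in> skew_forms" and inj: "\<And>x. b *v x = 0 \<Longrightarrow> x = 0"
    and \<kappa>: "inj_on \<kappa> {..<n}"
    and ev: "\<And>i. i < n \<Longrightarrow> \<exists>x. x \<noteq> 0 \<and> a *v x = \<kappa> i *s (b *v x)"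
  shows "has_Kronecker_form mat_scale mat_scale sl skew_forms
    (\<lambda>X. congruence_rep X a) (\<lambda>X. congruence_rep X b)
    (replicate (3 * n) (Horizontal 1) @ replicate (2 * n * (n - 1)) (Horizontal 2) @ [Vertical n])"
proof -
  obtain P P' where P: "P ** P' = Finite_Cartesian_Product.mat 1" "P' ** P = Finite_Cartesian_Product.mat 1"
    and ab: "a = P ** std_form \<kappa> ** Finite_Cartesian_Product.transpose P"
      "b = P ** std_form (\<lambda>_. 1) ** Finite_Cartesian_Product.transpose P"
    by (rule skew_pair_normal_form[OF a b inj \<kappa> ev])
  have T: "Finite_Cartesian_Product.transpose P ** Finite_Cartesian_Product.transpose P' = Finite_Cartesian_Product.mat 1"
    "Finite_Cartesian_Product.transpose P' ** Finite_Cartesian_Product.transpose P = Finite_Cartesian_Product.mat 1"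
    using P by (simp_all add: transpose_mat flip: matrix_transpose_mul)
  define \<phi> where "\<phi> X = P ** X ** P'" for X :: "complex^'n^'n"
  define \<psi> where "\<psi> Q = P ** Q ** Finite_Cartesian_Product.transpose P" for Q :: "complex^'n^'n"
  have add: "A ** (X + Y) ** B = A ** X ** B + A ** Y ** B"
    and scale: "A ** mat_scale c X ** B = mat_scale c (A ** X ** B)" for A B X Y :: "complex^'n^'n" and c
    by (simp_all add: congruence_simps sum.distrib sum_distrib_left algebra_simps)
  have lin: "Vector_Spaces.linear mat_scale mat_scale (\<lambda>X. A ** X ** B)" for A B :: "complex^'n^'n"
    by unfold_locales (simp_all add: add scale)
  have cancel: "A' ** (A ** X ** B) ** B' = X" if "A' ** A = Finite_Cartesian_Product.mat 1"
    "B ** B' = Finite_Cartesian_Product.mat 1" for A A' B B' X :: "complex^'n^'n"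
  proof -
    have "A' ** (A ** X ** B) ** B' = (A' ** A) ** X ** (B ** B')" by (simp only: matrix_mul_assoc)
    then show ?thesis by (simp add: that)
  qed
  have equivariant: "congruence_rep (\<phi> X) (\<psi> Q) = \<psi> (congruence_rep X Q)" for X Q
  proof -
    have "\<phi> X ** \<psi> Q = P ** X ** (P' ** P) ** Q ** Finite_Cartesian_Product.transpose P"
      by (simp only: \<phi>_def \<psi>_def matrix_mul_assoc)
    moreover have "\<psi> Q ** Finite_Cartesian_Product.transpose (\<phi> X) = P ** Q **
        (Finite_Cartesian_Product.transpose P ** Finite_Cartesian_Product.transpose P') **
        Finite_Cartesian_Product.transpose X ** Finite_Cartesian_Product.transpose P"
      by (simp only: \<phi>_def \<psi>_def matrix_mul_assoc matrix_transpose_mul)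
    moreover have "P ** (A + B) ** C = P ** A ** C + P ** B ** C" for A B C :: "complex^'n^'n" by (rule add)
    ultimately show ?thesis
      by (simp add: congruence_rep_def P T \<psi>_def matrix_mul_assoc)
  qed
  have tr: "A ** X ** A' \<in> sl" if "X \<in> sl" "A' ** A = Finite_Cartesian_Product.mat 1" for A A' X :: "complex^'n^'n"
  proof -
    have "trace (A ** X ** A') = trace (A' ** (A ** X))" by (rule trace_mul_sym)
    also have "A' ** (A ** X) = X" by (simp add: matrix_mul_assoc that)
    finally show ?thesis using that by (simp add: sl_def)
  qed
  have sk: "A ** Q ** Finite_Cartesian_Product.transpose A \<in> skew_forms" if "Q \<in> skew_forms" for A Q :: "complex^'n^'n"
  proof -
    have "A ** (- Q) ** B = - (A ** Q ** B)" for B :: "complex^'n^'n" using scale[of A "-1" Q B] by simp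
    then show ?thesis using that
      by (simp add: skew_forms_def matrix_transpose_mul matrix_mul_assoc)
  qed
  have "\<phi> ` sl = sl"
  proof (intro equalityI subsetI)
    show "X \<in> sl" if "X \<in> \<phi> ` sl" for X using that tr P by (auto simp: \<phi>_def)
    show "X \<in> \<phi> ` sl" if "X \<in> sl" for X
    proof (rule image_eqI)
      show "X = \<phi> (P' ** X ** P)" unfolding \<phi>_def using cancel[of P P' P P' X] P by simp
      show "P' ** X ** P \<in> sl" using that P by (intro tr) auto
    qed
  qed
  moreover have "\<psi> ` skew_forms = skew_forms"
  proof (intro equalityI subsetI)
    show "Q \<in> skew_forms" if "Q \<in> \<psi> ` skew_forms" for Q using that sk by (auto simp: \<psi>_def)
    show "Q \<in> \<psi> ` skew_forms" if "Q \<in> skew_forms" for Q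
    proof (rule image_eqI)
      show "Q = \<psi> (P' ** Q ** Finite_Cartesian_Product.transpose P')" unfolding \<psi>_def using cancel P T by simp
      show "P' ** Q ** Finite_Cartesian_Product.transpose P' \<in> skew_forms" using that by (rule sk)
    qed
  qed
  moreover have "inj_on \<phi> sl"
    using cancel[OF P(2) P(2)] by (intro inj_on_inverseI[of _ "\<lambda>X. P' ** X ** P"]) (simp add: \<phi>_def)
  moreover have "inj_on \<psi> skew_forms"
    using cancel[OF P(2) T(1)]
    by (intro inj_on_inverseI[of _ "\<lambda>Q. P' ** Q ** Finite_Cartesian_Product.transpose P'"]) (simp add: \<psi>_def)
  moreover have "Vector_Spaces.linear mat_scale mat_scale \<phi>" "Vector_Spaces.linear mat_scale mat_scale \<psi>"
    unfolding \<phi>_def \<psi>_def by (rule lin)+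
  moreover have "a = \<psi> (std_form \<kappa>)" "b = \<psi> (std_form (\<lambda>_. 1))" using ab by (simp_all add: \<psi>_def)
  ultimately show ?thesis
    using has_Kronecker_form_transport[of mat_scale mat_scale \<phi> sl mat_scale mat_scale \<psi> skew_forms
      "\<lambda>X. congruence_rep X a" "\<lambda>X. congruence_rep X (std_form \<kappa>)"
      "\<lambda>X. congruence_rep X b" "\<lambda>X. congruence_rep X (std_form (\<lambda>_. 1))", OF _ _ _ _ _ _ std_form_Kronecker[OF n \<kappa>]]
    by (simp add: equivariant)
qed

end

section \<open>Eigenvalues and power sums\<close>

definition mat_trace :: "complex Matrix.mat \<Rightarrow> complex" where
  "mat_trace A = (\<Sum>i<dim_row A. A $$ (i, i))"

lemma mat_trace_comm:
  assumes "A \<in> carrier_mat n m" "B \<in> carrier_mat m n"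
  shows "mat_trace (A * B) = mat_trace (B * A)"
proof -
  have "mat_trace (A * B) = (\<Sum>i<n. \<Sum>k<m. A $$ (i, k) * B $$ (k, i))"
    using assms by (auto simp: mat_trace_def scalar_prod_def lessThan_atLeast0 intro!: sum.cong)
  also have "\<dots> = (\<Sum>k<m. \<Sum>i<n. A $$ (i, k) * B $$ (k, i))" by (rule sum.swap)
  also have "\<dots> = mat_trace (B * A)"
    using assms by (auto simp: mat_trace_def scalar_prod_def lessThan_atLeast0 mult.commute intro!: sum.cong)
  finally show ?thesis .
qed

text \<open>Both claims go through one induction: in the sum for an entry on or below the diagonal,
  the zeros of the two factors leave at most the diagonal term.\<close>

lemma upper_triangular_power:
  assumes B: "B \<in> carrier_mat m m" "upper_triangular (B :: complex Matrix.mat)"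
  shows "(\<forall>i<m. \<forall>j<i. (B ^\<^sub>m k) $$ (i, j) = 0) \<and> (\<forall>i<m. (B ^\<^sub>m k) $$ (i, i) = B $$ (i, i) ^ k)"
proof (induction k)
  case 0
  then show ?case using B by auto
next
  case (Suc k)
  have Bk: "B ^\<^sub>m k \<in> carrier_mat m m" using B by simp
  have entry: "(B ^\<^sub>m Suc k) $$ (i, j) = (\<Sum>l<m. (B ^\<^sub>m k) $$ (i, l) * B $$ (l, j))" if "i < m" "j < m" for i j
    using that B Bk by (simp add: scalar_prod_def lessThan_atLeast0)
  have ut: "B $$ (l, j) = 0" if "l < m" "j < l" for l j using B that by (auto dest: upper_triangularD)
  have "(B ^\<^sub>m k) $$ (i, l) * B $$ (l, j) = 0" if "i < m" "j \<le> i" "l < m" "\<not> (l = i \<and> j = i)" for i j l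
    using that Suc ut by (cases "l < i") auto
  then have z: "(B ^\<^sub>m Suc k) $$ (i, j) = (\<Sum>l<m. if l = i \<and> j = i then (B ^\<^sub>m k) $$ (i, i) * B $$ (i, i) else 0)"
    if "i < m" "j \<le> i" for i j
    unfolding entry[OF that(1) order.strict_trans1[OF that(2,1)]]
    using that by (intro sum.cong) auto
  show ?case
    using z Suc by auto
qed

text \<open>Schur decomposition: the trace of a power is invariant under similarity and is read off
  the diagonal of the triangular form. \<open>es\<close> lists the eigenvalues with
  multiplicity.\<close>

lemma trace_powers_eigenvalues:
  assumes A: "A \<in> carrier_mat m m"
  obtains es where "\<And>t. t \<in> set es \<Longrightarrow> eigenvalue A t"
    "\<And>k. mat_trace (A ^\<^sub>m k) = (\<Sum>t\<leftarrow>es. t ^ k)"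
proof -
  obtain es where es: "char_poly A = (\<Prod>a\<leftarrow>es. [:- a, 1:])" "length es = m"
    using char_poly_factorized[OF A] by blast
  obtain B P Q where "schur_decomposition A es = (B, P, Q)" by (cases "schur_decomposition A es")
  from schur_decomposition[OF A es(1) this]
  have wit: "similar_mat_wit A B P Q" and B: "upper_triangular B" "diag_mat B = es" by auto
  note w = similar_mat_witD2[OF A wit]
  have "eigenvalue A t" if "t \<in> set es" for t
    using that by (auto simp: eigenvalue_root_char_poly[OF A] es(1) poly_prod_list prod_list_zero_iff)
  moreover have "mat_trace (A ^\<^sub>m k) = (\<Sum>t\<leftarrow>es. t ^ k)" for k
  proof -
    have Bk: "B ^\<^sub>m k \<in> carrier_mat m m" using w by simp
    have "A ^\<^sub>m k = P * (B ^\<^sub>m k * Q)"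
      using similar_mat_wit_pow_id[OF wit, of k] w Bk by (simp add: assoc_mult_mat[of _ m m _ m _ m])
    then have "mat_trace (A ^\<^sub>m k) = mat_trace (P * (B ^\<^sub>m k * Q))" by (rule arg_cong)
    also have "\<dots> = mat_trace (B ^\<^sub>m k * Q * P)"
      by (rule mat_trace_comm[of _ m m]) (use w Bk in auto)
    also have "B ^\<^sub>m k * Q * P = B ^\<^sub>m k"
      using w Bk by (simp add: assoc_mult_mat[of _ m m _ m _ m])
    also have "mat_trace (B ^\<^sub>m k) = (\<Sum>i<m. B $$ (i, i) ^ k)"
      using upper_triangular_power[OF w(5) B(1), of k] Bk w(5)
      by (simp add: mat_trace_def)
    also have "\<dots> = (\<Sum>t\<leftarrow>es. t ^ k)"
      using w(5) by (simp add: B(2)[symmetric] diag_mat_def o_def interv_sum_list_conv_sum_set_nat lessThan_atLeast0)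
    finally show ?thesis .
  qed
  ultimately show thesis by (rule that)
qed

text \<open>This Hankel matrix is V^T V for the Vandermonde matrix V of the eigenvalues of
  \<open>A\<close>, with powers below n. Its entries are polynomial in those of \<open>A\<close>,
  unlike the eigenvalues themselves.\<close>

definition power_sum_matrix :: "nat \<Rightarrow> complex Matrix.mat \<Rightarrow> complex Matrix.mat" where
  "power_sum_matrix n A = Matrix.mat n n (\<lambda>(i, j). mat_trace (A ^\<^sub>m (i + j)))"

text \<open>This is V^T (V v): with v read as the coefficients of a polynomial, V v lists its values
  at the eigenvalues.\<close>

lemma power_sum_matrix_mult_vec:
  assumes "v \<in> carrier_vec n" "i < n" "\<And>k. mat_trace (A ^\<^sub>m k) = (\<Sum>t\<leftarrow>es. t ^ k)"
  shows "vec_index (power_sum_matrix n A *\<^sub>v v) i = (\<Sum>t\<leftarrow>es. t ^ i * (\<Sum>j<n. vec_index v j * t ^ j))"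
proof -
  have "vec_index (power_sum_matrix n A *\<^sub>v v) i = (\<Sum>j<n. (\<Sum>t\<leftarrow>es. t ^ (i + j)) * vec_index v j)"
    using assms by (simp add: power_sum_matrix_def scalar_prod_def lessThan_atLeast0)
  also have "\<dots> = (\<Sum>t\<leftarrow>es. t ^ i * (\<Sum>j<n. vec_index v j * t ^ j))"
    by (induction es) (simp_all add: algebra_simps sum.distrib power_add sum_distrib_left)
  finally show ?thesis .
qed

text \<open>With fewer than \<open>n\<close> distinct eigenvalues, the coefficients of the polynomial having them as simple
  roots lie in the kernel of \<^const>\<open>power_sum_matrix\<close>.\<close>

lemma distinct_eigenvalues_if_power_sums:
  assumes A: "A \<in> carrier_mat m m" and det: "Determinant.det (power_sum_matrix n A) \<noteq> 0"
  obtains \<mu> where "inj_on \<mu> {..<n}" "\<And>i. i < n \<Longrightarrow> eigenvalue A (\<mu> i)"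
proof -
  obtain es where es: "\<And>t. t \<in> set es \<Longrightarrow> eigenvalue A t" "\<And>k. mat_trace (A ^\<^sub>m k) = (\<Sum>t\<leftarrow>es. t ^ k)"
    by (rule trace_powers_eigenvalues[OF A]) blast
  have "n \<le> card (set es)"
  proof (rule ccontr)
    assume "\<not> n \<le> card (set es)"
    define q where "q = (\<Prod>t\<in>set es. [:- t, 1:])"
    have deg: "degree q = card (set es)" by (simp add: q_def degree_prod_eq_sum_degree)
    have lead: "lead_coeff q = 1" unfolding q_def lead_coeff_prod by simp
    have root: "poly q t = 0" if "t \<in> set es" for t
      using that by (auto simp: q_def poly_prod prod_zero_iff)
    have eval: "(\<Sum>j<n. coeff q j * t ^ j) = poly q t" for t
      unfolding poly_altdef using deg \<open>\<not> n \<le> card (set es)\<close>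
      by (intro sum.mono_neutral_right) (auto simp: coeff_eq_0)
    define v where "v = Matrix.vec n (coeff q)"
    have v: "v \<in> carrier_vec n" by (simp add: v_def)
    \<comment> \<open>The degree of \<open>q\<close> is below n, so its leading coefficient 1
      survives in \<open>v\<close>.\<close>
    have "vec_index v (degree q) = 1" using deg lead \<open>\<not> n \<le> card (set es)\<close> by (simp add: v_def)
    then have v0: "v \<noteq> 0\<^sub>v n" using deg \<open>\<not> n \<le> card (set es)\<close> by auto
    have carr: "power_sum_matrix n A \<in> carrier_mat n n" by (simp add: power_sum_matrix_def)
    have "power_sum_matrix n A *\<^sub>v v = 0\<^sub>v n"
    proof (rule eq_vecI)
      fix i assume "i < dim_vec (0\<^sub>v n :: complex Matrix.vec)"
      then have i: "i < n" by simp
      have "(\<Sum>t\<leftarrow>es. t ^ i * (\<Sum>j<n. vec_index v j * t ^ j)) = (\<Sum>t\<leftarrow>es. 0)"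
        using root eval by (intro arg_cong[of _ _ sum_list] map_cong refl) (simp add: v_def)
      then show "vec_index (power_sum_matrix n A *\<^sub>v v) i = vec_index (0\<^sub>v n) i"
        unfolding power_sum_matrix_mult_vec[OF v i es(2)] using i by (simp add: sum_list_triv)
    qed (use carr in auto)
    then show False using det det_0_iff_vec_prod_zero[OF carr] v v0 by blast
  qed
  then obtain R where R: "R \<subseteq> set es" "card R = n" "finite R"
    by (metis obtain_subset_with_card_n)
  then obtain \<mu> where "bij_betw \<mu> {0..<n} R" using ex_bij_betw_nat_finite by blast
  then have \<mu>: "inj_on \<mu> {..<n}" "\<mu> ` {..<n} = R" by (auto simp: bij_betw_def lessThan_atLeast0)
  show thesis
  proof (rule that[OF \<mu>(1)])
    show "eigenvalue A (\<mu> i)" if "i < n" for i using that \<mu>(2) R(1) by (intro es(1)) auto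
  qed
qed

text \<open>The traces are those of a matrix with n distinct eigenvalues, each of them double. A
  kernel vector is a polynomial of degree below n; the transposed Vandermonde system forces its
  values at the \<mu>_i to vanish, and then it has n roots.\<close>

lemma power_sum_det_nonzero:
  assumes \<mu>: "inj_on \<mu> {..<n}" and tr: "\<And>k. mat_trace (A ^\<^sub>m k) = (\<Sum>i<n. 2 * \<mu> i ^ k)"
  shows "Determinant.det (power_sum_matrix n A) \<noteq> 0"
proof
  assume "Determinant.det (power_sum_matrix n A) = 0"
  moreover have "power_sum_matrix n A \<in> carrier_mat n n" by (simp add: power_sum_matrix_def)
  ultimately obtain v where v: "v \<in> carrier_vec n" "v \<noteq> 0\<^sub>v n" "power_sum_matrix n A *\<^sub>v v = 0\<^sub>v n"
    using det_0_iff_vec_prod_zero by blast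
  define V where "V l = (\<Sum>j<n. vec_index v j * \<mu> l ^ j)" for l
  obtain c where c0: "\<And>i. i < n \<Longrightarrow> c i \<noteq> 0"
    and c_ex: "\<And>t. \<exists>g. (\<forall>i<n. t i = (\<Sum>j<n. g j * (c i * \<mu> i ^ j))) \<and> g (n - 1) = (\<Sum>i<n. t i)"
    by (rule interpolation_weights[OF \<mu>]) blast
  define es where "es = map \<mu> [0..<n] @ map \<mu> [0..<n]"
  have "mat_trace (A ^\<^sub>m k) = (\<Sum>t\<leftarrow>es. t ^ k)" for k
    by (simp add: tr es_def o_def interv_sum_list_conv_sum_set_nat lessThan_atLeast0 flip: sum_distrib_left)
  from power_sum_matrix_mult_vec[OF v(1) _ this]
  have zero: "(\<Sum>l<n. \<mu> l ^ i * V l) = 0" if "i < n" for i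
    using that v(3) by (simp add: V_def es_def o_def interv_sum_list_conv_sum_set_nat lessThan_atLeast0)
  have V0: "V l = 0" if l: "l < n" for l
  proof -
    \<comment> \<open>After cancelling c_i, \<open>g\<close> holds the coefficients of the
      polynomial that is 1 at \<mu>_l and 0 at the other nodes. Combining the equations
      \<open>zero\<close> with these coefficients isolates \<open>V l\<close>.\<close>
    obtain g where g: "\<And>i. i < n \<Longrightarrow> (if i = l then c i else 0) = (\<Sum>j<n. g j * (c i * \<mu> i ^ j))"
      using c_ex[of "\<lambda>i. if i = l then c i else 0"] by auto
    have g': "(\<Sum>j<n. g j * \<mu> i ^ j) = (if i = l then 1 else 0)" if "i < n" for i
    proof -
      have "c i * (\<Sum>j<n. g j * \<mu> i ^ j) = c i * (if i = l then 1 else 0)"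
        using g[OF that] by (simp add: sum_distrib_left algebra_simps split: if_splits)
      then show ?thesis using c0[OF that] by simp
    qed
    have "V l = (\<Sum>i<n. (if i = l then 1 else 0) * V i)"
      using l by (simp add: if_distrib[of "\<lambda>x. x * _"] cong: if_cong)
    also have "\<dots> = (\<Sum>i<n. (\<Sum>j<n. g j * \<mu> i ^ j) * V i)"
      by (intro sum.cong) (auto simp: g')
    also have "\<dots> = (\<Sum>i<n. \<Sum>j<n. g j * (\<mu> i ^ j * V i))"
      by (simp add: sum_distrib_right mult.assoc)
    also have "\<dots> = (\<Sum>j<n. \<Sum>i<n. g j * (\<mu> i ^ j * V i))" by (rule sum.swap)
    also have "\<dots> = 0" by (simp add: zero flip: sum_distrib_left)
    finally show ?thesis .
  qed
  define q where "q = (\<Sum>j<n. monom (vec_index v j) j)"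
  have n: "n > 0" using v by (cases n) auto
  have "q = 0"
  proof (rule poly_eqI_degree[of "\<mu> ` {..<n}"])
    show "poly q x = poly 0 x" if "x \<in> \<mu> ` {..<n}" for x
      using that V0 by (auto simp: q_def poly_sum poly_monom V_def)
    have "degree q \<le> n - 1"
      unfolding q_def by (intro degree_sum_le) (auto intro: order.trans[OF degree_monom_le])
    then show "degree q < card (\<mu> ` {..<n})" using n \<mu> by (simp add: card_image)
    show "degree (0 :: complex poly) < card (\<mu> ` {..<n})" using n \<mu> by (simp add: card_image)
  qed
  then have "vec_index v i = 0" if "i < n" for i
  proof -
    have "coeff q i = vec_index v i" using that by (simp add: q_def coeff_sum)
    then show ?thesis using \<open>q = 0\<close> by simp
  qed
  then have "v = 0\<^sub>v n" using v(1) by (intro eq_vecI) auto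
  then show False using v(2) by simp
qed

section \<open>Genericity\<close>

lemma polynomial_functions_sum:
  "(\<And>i. i \<in> I \<Longrightarrow> f i \<in> polynomial_functions s) \<Longrightarrow> (\<lambda>x. \<Sum>i\<in>I. f i x) \<in> polynomial_functions s"
  by (induction I rule: infinite_finite_induct)
    (simp_all add: polynomial_functions.const polynomial_functions.add)

lemma polynomial_functions_prod:
  "(\<And>i. i \<in> I \<Longrightarrow> f i \<in> polynomial_functions s) \<Longrightarrow> (\<lambda>x. \<Prod>i\<in>I. f i x) \<in> polynomial_functions s"
  by (induction I rule: infinite_finite_induct)
    (simp_all add: polynomial_functions.const polynomial_functions.mult)

definition polynomial_mat :: "(complex \<Rightarrow> 'v::ab_group_add \<Rightarrow> 'v) \<Rightarrow> nat \<Rightarrow> nat \<Rightarrow> ('v \<Rightarrow> complex Matrix.mat) \<Rightarrow> bool" where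
  "polynomial_mat s r c F \<longleftrightarrow> (\<forall>x. F x \<in> carrier_mat r c) \<and>
     (\<forall>i<r. \<forall>j<c. (\<lambda>x. F x $$ (i, j)) \<in> polynomial_functions s)"

lemma polynomial_mat_mult:
  assumes "polynomial_mat s r m F" "polynomial_mat s m c G"
  shows "polynomial_mat s r c (\<lambda>x. F x * G x)"
proof -
  have carr: "F x \<in> carrier_mat r m" "G x \<in> carrier_mat m c" for x
    using assms by (auto simp: polynomial_mat_def)
  have "(F x * G x) $$ (i, j) = (\<Sum>l<m. F x $$ (i, l) * G x $$ (l, j))" if "i < r" "j < c" for x i j
    using that by (simp add: scalar_prod_def lessThan_atLeast0 carrier_matD[OF carr(1)] carrier_matD[OF carr(2)])
  then show ?thesis
    using assms mult_carrier_mat[OF carr] unfolding polynomial_mat_def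
    by (auto intro!: polynomial_functions_sum polynomial_functions.mult)
qed

lemma polynomial_mat_power:
  assumes "polynomial_mat s m m F"
  shows "polynomial_mat s m m (\<lambda>x. F x ^\<^sub>m k)"
proof (induction k)
  case 0
  have "dim_row (F x) = m" for x using assms by (auto simp: polynomial_mat_def)
  then show ?case by (auto simp: polynomial_mat_def polynomial_functions.const)
next
  case (Suc k)
  then show ?case using polynomial_mat_mult[OF Suc assms] by simp
qed

lemma polynomial_mat_det:
  assumes "polynomial_mat s m m F"
  shows "(\<lambda>x. Determinant.det (F x)) \<in> polynomial_functions s"
proof -
  have "F x \<in> carrier_mat m m" for x using assms by (auto simp: polynomial_mat_def)
  then have "Determinant.det (F x) = (\<Sum>p\<in>{p. p permutes {0..<m}}. signof p * (\<Prod>i = 0..<m. F x $$ (i, p i)))" for x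
    by (rule det_def')
  moreover have "p i < m" if "p permutes {0..<m}" "i < m" for p i
    using that permutes_in_image[of p "{0..<m}" i] by simp
  ultimately show ?thesis using assms
    by (auto simp: polynomial_mat_def
        intro!: polynomial_functions_sum polynomial_functions.mult polynomial_functions.const polynomial_functions_prod)
qed

text \<open>The entries of the adjugate are signed minors.\<close>

lemma polynomial_mat_adj:
  assumes "polynomial_mat s m m F"
  shows "polynomial_mat s m m (\<lambda>x. adj_mat (F x))"
proof -
  have carr: "F x \<in> carrier_mat m m" for x using assms by (auto simp: polynomial_mat_def)
  have "polynomial_mat s (m - 1) (m - 1) (\<lambda>x. mat_delete (F x) j i)" if "i < m" "j < m" for i j
    using assms that unfolding polynomial_mat_def mat_delete_def
    by (auto simp: carrier_matD[OF carr])
  then have "(\<lambda>x. cofactor (F x) j i) \<in> polynomial_functions s" if "i < m" "j < m" for i j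
    unfolding cofactor_def using that
    by (intro polynomial_functions.mult polynomial_functions.const polynomial_mat_det)
  moreover have "adj_mat (F x) $$ (i, j) = cofactor (F x) j i" if "i < m" "j < m" for i j x
    using carr[of x] that by (simp add: adj_mat_def)
  ultimately show ?thesis using adj_mat(1)[OF carr] by (auto simp: polynomial_mat_def)
qed

section \<open>The open set of regular pairs\<close>

context paired_enumeration
begin

text \<open>Translates to matrices indexed by numbers, on which the adjugate and the Schur
  decomposition are taken.\<close>

definition to_mat :: "complex^'n^'n \<Rightarrow> complex Matrix.mat" where
  "to_mat X = Matrix.mat (2 * n) (2 * n) (\<lambda>(i, j). X $ e i $ e j)"

lemma to_mat_carrier [simp]: "to_mat X \<in> carrier_mat (2 * n) (2 * n)"
  by (simp add: to_mat_def)

lemma to_mat_mult: "to_mat (X ** Y) = to_mat X * to_mat Y"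
proof (rule eq_matI)
  fix i j assume "i < dim_row (to_mat X * to_mat Y)" "j < dim_col (to_mat X * to_mat Y)"
  then have ij: "i < 2 * n" "j < 2 * n" by (auto simp: to_mat_def)
  have "(X ** Y) $ e i $ e j = (\<Sum>k<2 * n. X $ e i $ e k * Y $ e k $ e j)"
    unfolding matrix_matrix_mult_def vec_lambda_beta by (rule sum.reindex_bij_betw[OF bij, symmetric])
  then show "to_mat (X ** Y) $$ (i, j) = (to_mat X * to_mat Y) $$ (i, j)"
    using ij by (simp add: to_mat_def scalar_prod_def lessThan_atLeast0)
qed (auto simp: to_mat_def)

lemma to_mat_mult_vec:
  assumes "v \<in> carrier_vec (2 * n)" "i < 2 * n"
  shows "vec_index (to_mat X *\<^sub>v v) i = (X *v (\<chi> p. vec_index v (idx p))) $ e i"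
proof -
  have "(X *v (\<chi> p. vec_index v (idx p))) $ e i = (\<Sum>k<2 * n. X $ e i $ e k * vec_index v (idx (e k)))"
    unfolding matrix_vector_mult_def vec_lambda_beta by (rule sum.reindex_bij_betw[OF bij, symmetric])
  then show ?thesis using assms by (simp add: to_mat_def scalar_prod_def lessThan_atLeast0)
qed

text \<open>For invertible b this is det(b) b^-1 a. The adjugate keeps the entries polynomial, and
  the factor det(b) scales all eigenvalues alike, so distinct ones stay distinct.\<close>

definition scaled_quotient :: "(complex^'n^'n) \<times> (complex^'n^'n) \<Rightarrow> complex Matrix.mat" where
  "scaled_quotient = (\<lambda>(a, b). adj_mat (to_mat b) * to_mat a)"

text \<open>One polynomial for both conditions: the first factor makes b invertible, the second
  forces n distinct eigenvalues.\<close>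

definition regularity :: "(complex^'n^'n) \<times> (complex^'n^'n) \<Rightarrow> complex" where
  "regularity ab = Determinant.det (to_mat (snd ab)) * Determinant.det (power_sum_matrix n (scaled_quotient ab))"

lemma scaled_quotient_carrier: "scaled_quotient ab \<in> carrier_mat (2 * n) (2 * n)"
  by (auto simp: scaled_quotient_def split: prod.splits intro!: mult_carrier_mat adj_mat(1))

lemma regularity_polynomial:
  "regularity \<in> polynomial_functions (module_prod.scale mat_scale mat_scale)" (is "_ \<in> polynomial_functions ?s")
proof -
  interpret p: vector_space_prod mat_scale mat_scale by unfold_locales
  have "vector_space ((*) :: complex \<Rightarrow> complex \<Rightarrow> complex)" by unfold_locales (auto simp: algebra_simps)
  then have lin: "Vector_Spaces.linear ?s (*) (\<lambda>x. fst x $ p $ q)" "Vector_Spaces.linear ?s (*) (\<lambda>x. snd x $ p $ q)" for p q :: 'n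
    using p.p.vector_space_axioms by (auto simp: Vector_Spaces.linear_iff p.scale_def)
  have ab: "polynomial_mat ?s (2 * n) (2 * n) (\<lambda>x. to_mat (fst x))" "polynomial_mat ?s (2 * n) (2 * n) (\<lambda>x. to_mat (snd x))"
    unfolding polynomial_mat_def by (auto simp: to_mat_def intro!: polynomial_functions.linear lin)
  have M: "polynomial_mat ?s (2 * n) (2 * n) (\<lambda>x. adj_mat (to_mat (snd x)) * to_mat (fst x))"
    by (rule polynomial_mat_mult[OF polynomial_mat_adj[OF ab(2)] ab(1)])
  then have M': "polynomial_mat ?s (2 * n) (2 * n) scaled_quotient"
    by (simp add: scaled_quotient_def case_prod_unfold)
  have tr: "(\<lambda>x. mat_trace (scaled_quotient x ^\<^sub>m k)) \<in> polynomial_functions ?s" for k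
  proof -
    have "dim_row (scaled_quotient x ^\<^sub>m k) = 2 * n" for x
      using pow_carrier_mat[OF scaled_quotient_carrier[of x], of k] by auto
    then show ?thesis
      using polynomial_mat_power[OF M', of k] unfolding mat_trace_def polynomial_mat_def
      by (auto intro!: polynomial_functions_sum)
  qed
  have gram: "polynomial_mat ?s n n (\<lambda>x. power_sum_matrix n (scaled_quotient x))"
    unfolding polynomial_mat_def power_sum_matrix_def by (auto intro: tr)
  show ?thesis
    unfolding regularity_def
    by (intro polynomial_functions.mult polynomial_mat_det[OF gram] polynomial_mat_det[OF ab(2)])
qed

text \<open>Applying b to adj(b) a v = \<mu> v gives det(b) a v = \<mu> b v, so \<kappa> = \<mu> /
  det(b).\<close>

lemma regular_pair_eigenvalues:
  assumes "regularity (a, b) \<noteq> 0"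
  obtains \<kappa> where "inj_on \<kappa> {..<n}" "\<And>i. i < n \<Longrightarrow> \<exists>x. x \<noteq> 0 \<and> a *v x = \<kappa> i *s (b *v x)"
    "\<And>x. b *v x = 0 \<Longrightarrow> x = 0"
proof -
  define \<delta> where "\<delta> = Determinant.det (to_mat b)"
  have \<delta>: "\<delta> \<noteq> 0" and det: "Determinant.det (power_sum_matrix n (scaled_quotient (a, b))) \<noteq> 0"
    using assms by (auto simp: regularity_def \<delta>_def)
  obtain \<mu> where \<mu>: "inj_on \<mu> {..<n}" "\<And>i. i < n \<Longrightarrow> eigenvalue (scaled_quotient (a, b)) (\<mu> i)"
    by (rule distinct_eigenvalues_if_power_sums[OF scaled_quotient_carrier det]) blast
  let ?A = "to_mat a" and ?B = "to_mat b"
  note adj = adj_mat[OF to_mat_carrier[of b]]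
  have "\<exists>x. x \<noteq> 0 \<and> a *v x = (\<mu> i / \<delta>) *s (b *v x)" if i: "i < n" for i
  proof -
    obtain v where v: "v \<in> carrier_vec (2 * n)" "v \<noteq> 0\<^sub>v (2 * n)" "scaled_quotient (a, b) *\<^sub>v v = \<mu> i \<cdot>\<^sub>v v"
      using \<mu>(2)[OF i] scaled_quotient_carrier[of "(a, b)"] by (auto simp: eigenvalue_def eigenvector_def)
    define x where "x = (\<chi> p. vec_index v (idx p))"
    have "\<mu> i \<cdot>\<^sub>v (?B *\<^sub>v v) = ?B *\<^sub>v (scaled_quotient (a, b) *\<^sub>v v)"
      unfolding v(3) using v(1) by (simp add: mult_mat_vec[OF to_mat_carrier])
    also have "\<dots> = (?B * (adj_mat ?B * ?A)) *\<^sub>v v"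
      using assoc_mult_mat_vec[OF to_mat_carrier[of b] scaled_quotient_carrier[of "(a, b)"] v(1)]
      by (simp add: scaled_quotient_def)
    also have "?B * (adj_mat ?B * ?A) = (?B * adj_mat ?B) * ?A"
      by (rule assoc_mult_mat[OF to_mat_carrier adj(1) to_mat_carrier, symmetric])
    also have "\<dots> = \<delta> \<cdot>\<^sub>m ?A"
      unfolding adj(2) \<delta>_def[symmetric] by (simp add: mult_smult_assoc_mat[of _ "2 * n" "2 * n" _ "2 * n"] left_mult_one_mat[OF to_mat_carrier])
    finally have eq: "\<mu> i \<cdot>\<^sub>v (?B *\<^sub>v v) = (\<delta> \<cdot>\<^sub>m ?A) *\<^sub>v v" .
    have "\<mu> i * (b *v x) $ p = \<delta> * (a *v x) $ p" for p
    proof -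
      have "vec_index (\<mu> i \<cdot>\<^sub>v (?B *\<^sub>v v)) (idx p) = \<mu> i * (b *v x) $ p"
        using v(1) to_mat_mult_vec[OF v(1), of "idx p" b] by (simp add: x_def to_mat_def)
      moreover have "vec_index ((\<delta> \<cdot>\<^sub>m ?A) *\<^sub>v v) (idx p) = \<delta> * (a *v x) $ p"
      proof -
        have "vec_index ((\<delta> \<cdot>\<^sub>m ?A) *\<^sub>v v) (idx p) = \<delta> * vec_index (?A *\<^sub>v v) (idx p)"
          using v(1) by (simp add: to_mat_def scalar_prod_def sum_distrib_left mult.assoc)
        then show ?thesis using to_mat_mult_vec[OF v(1), of "idx p" a] by (simp add: x_def)
      qed
      ultimately show ?thesis using eq by simp
    qed
    then have "a *v x = (\<mu> i / \<delta>) *s (b *v x)"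
      using \<delta> by (simp add: Finite_Cartesian_Product.vec_eq_iff field_simps)
    moreover have "x \<noteq> 0"
    proof
      assume "x = 0"
      have "vec_index v j = 0" if "j < 2 * n" for j
        using arg_cong[OF \<open>x = 0\<close>, of "\<lambda>x. x $ e j"] that by (simp add: x_def)
      then have "v = 0\<^sub>v (2 * n)" using v(1) by (intro eq_vecI) auto
      then show False using v(2) by simp
    qed
    ultimately show ?thesis by blast
  qed
  moreover have "inj_on (\<lambda>i. \<mu> i / \<delta>) {..<n}" using \<mu>(1) \<delta> by (auto simp: inj_on_def)
  moreover have "x = 0" if "b *v x = 0" for x
  proof -
    define v where "v = Matrix.vec (2 * n) (\<lambda>i. x $ e i)"
    have v: "v \<in> carrier_vec (2 * n)" by (simp add: v_def)
    have x: "(\<chi> p. vec_index v (idx p)) = x" by (simp add: v_def Finite_Cartesian_Product.vec_eq_iff)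
    have "?B *\<^sub>v v = 0\<^sub>v (2 * n)"
      using to_mat_mult_vec[OF v, of _ b] that by (intro eq_vecI) (auto simp: x to_mat_def)
    then have "v = 0\<^sub>v (2 * n)" using det_0_iff_vec_prod_zero[OF to_mat_carrier[of b]] v \<delta> by (auto simp: \<delta>_def)
    then have "x $ e i = 0" if "i < 2 * n" for i
      using that by (metis v_def index_vec index_zero_vec(1))
    from this[OF idx_less] show ?thesis by (simp add: Finite_Cartesian_Product.vec_eq_iff)
  qed
  ultimately show thesis using that by blast
qed

lemma std_form_skew: "std_form \<kappa> \<in> skew_forms"
proof -
  have "std_form \<kappa> $ p $ q = - (std_form \<kappa> $ q $ p)" for p q
  proof (cases "q = partner p")
    case True
    then show ?thesis by (simp add: std_form_def)
  next
    case False
    then have "p \<noteq> partner q" using partner_partner by metis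
    then show ?thesis using False by (simp add: std_form_def)
  qed
  then show ?thesis unfolding skew_forms_iff by blast
qed

text \<open>Shows that the open set is non-empty. The standard form is J D with D diagonal, so
  adj(J) J D = det(J) D, in which every det(J) \<kappa>_i occurs twice on the diagonal.\<close>

lemma regularity_std_form:
  assumes \<kappa>: "inj_on \<kappa> {..<n}"
  shows "regularity (std_form \<kappa>, std_form (\<lambda>_. 1)) \<noteq> 0"
proof -
  define J where "J = to_mat (std_form (\<lambda>_. 1))"
  define D where "D = (\<chi> p q. if p = q then \<kappa> (idx p mod n) else 0)"
  have row: "(std_form \<eta> ** X) $ p $ q = \<eta> (idx p mod n) * sgn_of p * X $ partner p $ q" for \<eta> X p q
  proof -
    have "(std_form \<eta> ** X) $ p $ q =
      (\<Sum>k\<in>UNIV. if k = partner p then \<eta> (idx p mod n) * sgn_of p * X $ k $ q else 0)"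
      unfolding matrix_matrix_mult_def vec_lambda_beta by (intro sum.cong) (auto simp: std_form_def)
    then show ?thesis by simp
  qed
  \<comment> \<open>Since J^2 = -1, the inverse of J is - J; hence det J is not 0.\<close>
  have "std_form (\<lambda>_. - 1) ** std_form (\<lambda>_. 1) = Finite_Cartesian_Product.mat 1"
  proof (rule mat_eqI)
    fix p q
    show "(std_form (\<lambda>_. - 1) ** std_form (\<lambda>_. 1)) $ p $ q = Finite_Cartesian_Product.mat 1 $ p $ q"
      unfolding row by (cases "p = q") (auto simp: std_form_def Finite_Cartesian_Product.mat_def)
  qed
  then have "to_mat (std_form (\<lambda>_. - 1)) * J = to_mat (Finite_Cartesian_Product.mat 1)"
    by (simp add: J_def flip: to_mat_mult)
  also have "\<dots> = 1\<^sub>m (2 * n)"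
  proof (rule eq_matI)
    show "to_mat (Finite_Cartesian_Product.mat 1) $$ (i, j) = 1\<^sub>m (2 * n) $$ (i, j)"
      if "i < dim_row (1\<^sub>m (2 * n))" "j < dim_col (1\<^sub>m (2 * n))" for i j
      using that by (auto simp: to_mat_def Finite_Cartesian_Product.mat_def dest: arg_cong[of "e i" _ idx])
  qed (auto simp: to_mat_def)
  finally have "Determinant.det (to_mat (std_form (\<lambda>_. - 1))) * Determinant.det J = 1"
    using Determinant.det_mult[OF to_mat_carrier to_mat_carrier] by (metis J_def Determinant.det_one)
  then have det: "Determinant.det J \<noteq> 0" by auto
  define \<delta> where "\<delta> = Determinant.det J"
  define M where "M = scaled_quotient (std_form \<kappa>, std_form (\<lambda>_. 1))"
  have "std_form \<kappa> = std_form (\<lambda>_. 1) ** D"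
  proof (rule mat_eqI)
    show "std_form \<kappa> $ p $ q = (std_form (\<lambda>_. 1) ** D) $ p $ q" for p q
      unfolding row by (auto simp: std_form_def D_def)
  qed
  then have "M = adj_mat J * (J * to_mat D)"
    by (simp add: M_def scaled_quotient_def J_def to_mat_mult)
  also have "\<dots> = (adj_mat J * J) * to_mat D"
    by (rule assoc_mult_mat[symmetric, of _ "2 * n" "2 * n" _ "2 * n" _ "2 * n"]) (auto simp: J_def adj_mat(1)[OF to_mat_carrier])
  also have "\<dots> = \<delta> \<cdot>\<^sub>m to_mat D"
    unfolding J_def adj_mat(3)[OF to_mat_carrier] \<delta>_def
    by (simp add: mult_smult_assoc_mat[of _ "2 * n" "2 * n" _ "2 * n"] left_mult_one_mat[OF to_mat_carrier])
  finally have M: "M = \<delta> \<cdot>\<^sub>m to_mat D" .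
  have M_carrier: "M \<in> carrier_mat (2 * n) (2 * n)" by (simp add: M)
  have "upper_triangular M"
    by (auto simp: M to_mat_def D_def upper_triangular_def dest: arg_cong[of "e _" _ idx])
  note pow = upper_triangular_power[OF M_carrier this]
  have "mat_trace (M ^\<^sub>m k) = (\<Sum>i<n. 2 * (\<delta> * \<kappa> i) ^ k)" for k
  proof -
    have "mat_trace (M ^\<^sub>m k) = (\<Sum>i<2 * n. M $$ (i, i) ^ k)"
      using pow[of k] M_carrier by (simp add: mat_trace_def)
    also have "\<dots> = (\<Sum>i<2 * n. (\<delta> * \<kappa> (idx (e i) mod n)) ^ k)"
      by (intro sum.cong) (auto simp: M to_mat_def D_def)
    also have "\<dots> = (\<Sum>p\<in>UNIV. (\<delta> * \<kappa> (idx p mod n)) ^ k)"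
      by (rule sum.reindex_bij_betw[OF bij])
    also have "\<dots> = (\<Sum>i<n. 2 * (\<delta> * \<kappa> i) ^ k)"
      unfolding sum_UNIV_paired by (intro sum.cong) auto
    finally show ?thesis .
  qed
  moreover have "inj_on (\<lambda>i. \<delta> * \<kappa> i) {..<n}" using \<kappa> det by (auto simp: inj_on_def \<delta>_def)
  ultimately have "Determinant.det (power_sum_matrix n M) \<noteq> 0" by (intro power_sum_det_nonzero)
  then show ?thesis using det by (simp add: regularity_def M_def J_def)
qed

end

section \<open>The generic algebraic type\<close>

lemma type_of_blocks_skew_pair:
  "type_of_blocks (replicate k (Horizontal 1) @ replicate m (Horizontal 2) @ [Vertical n]) =
     \<lparr> jordan_sizes = {#}, horizontal_indices = replicate_mset k 1 + replicate_mset m 2, vertical_indices = {#n#} \<rparr>"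
proof -
  let ?bs = "replicate k (Horizontal 1) @ replicate m (Horizontal 2) @ [Vertical n]"
  have ev: "block_eigenvalues ?bs = {}" by (auto simp: block_eigenvalues_def)
  have H: "concat (map (\<lambda>x. case x of Horizontal h \<Rightarrow> [h] | _ \<Rightarrow> []) (replicate k (Horizontal h))) = replicate k h"
    and V: "concat (map (\<lambda>x. case x of Vertical h \<Rightarrow> [h] | _ \<Rightarrow> []) (replicate k (Horizontal h))) = []" for k h
    by (induction k) auto
  show ?thesis
    unfolding type_of_blocks_def ev by (simp add: H V)
qed

theorem theorem4p18:
  fixes n :: nat
  assumes "n \<ge> 1" and "CARD('n::finite) = 2 * n"
  shows "has_JK_invariants mat_scale mat_scale
           (sl :: (complex^'n^'n) set) skew_forms congruence_rep
           \<lparr> jordan_sizes = {#},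
             horizontal_indices = replicate_mset (3 * n) 1 + replicate_mset (2 * n * (n - 1)) 2,
             vertical_indices = {#n#} \<rparr>
       \<and> size (replicate_mset (3 * n) (1::nat) + replicate_mset (2 * n * (n - 1)) 2) = n * (2 * n + 1)"
proof
  obtain e :: "nat \<Rightarrow> 'n" where "bij_betw e {0..<2 * n} UNIV"
    using ex_bij_betw_nat_finite[OF finite[of "UNIV :: 'n set"]] assms(2) by auto
  then interpret paired_enumeration n e by unfold_locales (simp add: lessThan_atLeast0)
  define Z where "Z = {ab \<in> skew_forms \<times> skew_forms. \<exists>f \<in> {regularity}. f ab \<noteq> 0}"
  have "Zariski_open_in (module_prod.scale mat_scale mat_scale) (skew_forms \<times> skew_forms) Z"
    unfolding Zariski_open_in_def Z_def using regularity_polynomial by (intro exI[of _ "{regularity}"]) auto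
  \<comment> \<open>The eigenvalues 0, ..., n - 1 are distinct in characteristic 0.\<close>
  moreover have "(std_form of_nat, std_form (\<lambda>_. 1)) \<in> Z"
    unfolding Z_def using std_form_skew regularity_std_form[of of_nat] by (auto simp: inj_on_def)
  then have "Z \<noteq> {}" by blast
  moreover have "pencil_has_type mat_scale mat_scale sl skew_forms (\<lambda>X. congruence_rep X a) (\<lambda>X. congruence_rep X b)
      \<lparr> jordan_sizes = {#},
        horizontal_indices = replicate_mset (3 * n) 1 + replicate_mset (2 * n * (n - 1)) 2,
        vertical_indices = {#n#} \<rparr>" if "(a, b) \<in> Z" for a b
  proof -
    have ab: "a \<in> skew_forms" "b \<in> skew_forms" "regularity (a, b) \<noteq> 0" using that by (auto simp: Z_def)
    obtain \<kappa> where "inj_on \<kappa> {..<n}" "\<And>i. i < n \<Longrightarrow> \<exists>x. x \<noteq> 0 \<and> a *v x = \<kappa> i *s (b *v x)"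
      "\<And>x. b *v x = 0 \<Longrightarrow> x = 0"
      by (rule regular_pair_eigenvalues[OF ab(3)]) blast
    then show ?thesis
      using skew_pair_Kronecker[OF assms(1) ab(1,2)] type_of_blocks_skew_pair
      unfolding pencil_has_type_def by blast
  qed
  ultimately show "has_JK_invariants mat_scale mat_scale
           (sl :: (complex^'n^'n) set) skew_forms congruence_rep
           \<lparr> jordan_sizes = {#},
             horizontal_indices = replicate_mset (3 * n) 1 + replicate_mset (2 * n * (n - 1)) 2,
             vertical_indices = {#n#} \<rparr>"
    unfolding has_JK_invariants_def by blast
  show "size (replicate_mset (3 * n) (1::nat) + replicate_mset (2 * n * (n - 1)) 2) = n * (2 * n + 1)"
    using assms(1) by (cases n) (auto simp: algebra_simps)
qed

end
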